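(* Let $b,c>0$ and let $f$ be a differentiable function on $\mathbb{R}_+=[0,\infty)$ such that $f$ and $f'$ are continuous and, for some $\varepsilon>0$, both $f(x)=o(x^{-b-1-\varepsilon})$ and $f'(x)=o(x^{-b-1-\varepsilon})$ as $x\to+\infty$. Let $g(s)=[\widehat f(s)]_{b,c}$ be the index hypergeometric transform of $f$, considered as a holomorphic function in the strip $|\operatorname{Im}s|<1+\varepsilon$. Then the index hypergeometric transform of the function $x\mapsto x(x+1)f'(x)$ is $$\Bigl[\widehat{x(x+1)\tfrac{d}{dx}f}\Bigr]_{b,c}(s)=Hg(s),$$ where $H$ is the difference operator $$Hg(s)=\frac{(b-is)(b+1-is)(c-is)}{(2is)(1-2is)}\bigl(g(s+i)-g(s)\bigr)+\frac{(b+is)(b+1+is)(c+is)}{(-2is)(1+2is)}\bigl(g(s-i)-g(s)\bigr)-(b+c)g(s)$$ (for real $s$; the value at $s=0$ is understood by continuity).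
   Context: For $b,c>0$ the index hypergeometric transform of a function $f$ on $\mathbb{R}_+$ is $$[\widehat f(s)]_{b,c}=J_{b,c}f(s)=\frac1{\Gamma(b+c)}\int_0^\infty f(x)\,{}_2F_1(b+is,b-is;b+c;-x)\,x^{b+c-1}(1+x)^{b-c}\,dx,$$ where ${}_2F_1$ is the Gauss hypergeometric function (analytically continued to $\mathbb{C}\setminus[1,\infty)$ in its last argument) and $\int_0^\infty$ is understood as an improper integral $\lim_{N\to\infty}\int_0^N$. Under the decay hypothesis on $f$ the integral for $f$ defines a holomorphic function of $s$ in the strip $|\operatorname{Im}s|<1+\varepsilon$; values such as $g(s\pm i)$ for real $s$ refer to this holomorphic function. *)

theory Defs
  imports "HOL-Analysis.Analysis" "HOL-Library.Landau_Symbols"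
begin

definition slit_plane :: "complex set" where
  "slit_plane = UNIV - complex_of_real ` {1..}"

text \<open>The Gauss function \<open>2F1(a,b;c;z)\<close>: the analytic continuation of the hypergeometric series from
  the unit disc to the plane cut along \<open>[1,\<infinity>)\<close>. The continuation exists if \<open>c\<close> is not a
  nonpositive integer and is unique because the slit plane is connected; the values on the cut are
  unspecified.\<close>
definition gauss_2F1 :: "complex \<Rightarrow> complex \<Rightarrow> complex \<Rightarrow> complex \<Rightarrow> complex" where
  "gauss_2F1 a b c = (SOME F. F holomorphic_on slit_plane \<and>
     (\<forall>z\<in>ball 0 1. F z = eval_fps (fps_hypergeo [a, b] [c] 1) z))"

definition index_integrand ::
    "real \<Rightarrow> real \<Rightarrow> (real \<Rightarrow> complex) \<Rightarrow> complex \<Rightarrow> real \<Rightarrow> complex" where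
  "index_integrand b c f s x =
     f x * gauss_2F1 (of_real b + \<i> * s) (of_real b - \<i> * s) (of_real (b + c)) (- of_real x)
       * of_real (x powr (b + c - 1)) * of_real ((1 + x) powr (b - c))"

text \<open>The transform is an improper integral, the limit for \<open>N \<longlongrightarrow> \<infinity>\<close> of the following truncations.\<close>
definition index_truncated ::
    "real \<Rightarrow> real \<Rightarrow> (real \<Rightarrow> complex) \<Rightarrow> complex \<Rightarrow> real \<Rightarrow> complex" where
  "index_truncated b c f s N =
     of_real (1 / Gamma (b + c)) * integral {0..N} (index_integrand b c f s)"

definition index_converges ::
    "real \<Rightarrow> real \<Rightarrow> (real \<Rightarrow> complex) \<Rightarrow> complex \<Rightarrow> bool" where
  "index_converges b c f s \<longleftrightarrow>
     (\<forall>N\<ge>0. index_integrand b c f s integrable_on {0..N}) \<and>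
     (\<exists>l. (index_truncated b c f s \<longlongrightarrow> l) at_top)"

text \<open>Meaningful only when \<^const>\<open>index_converges\<close> holds.\<close>
definition index_transform ::
    "real \<Rightarrow> real \<Rightarrow> (real \<Rightarrow> complex) \<Rightarrow> complex \<Rightarrow> complex" where
  "index_transform b c f s = Lim at_top (index_truncated b c f s)"

text \<open>At \<open>s = 0\<close> the formula has vanishing denominators, and division by zero yields zero: there
  the value must be taken as the limit for \<open>s \<longlongrightarrow> 0\<close>, not as the value of this function.\<close>
definition diff_H :: "real \<Rightarrow> real \<Rightarrow> (complex \<Rightarrow> complex) \<Rightarrow> complex \<Rightarrow> complex" where
  "diff_H b c g s =
     (of_real b - \<i> * s) * (of_real b + 1 - \<i> * s) * (of_real c - \<i> * s)
       / ((2 * \<i> * s) * (1 - 2 * \<i> * s)) * (g (s + \<i>) - g s)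
   + (of_real b + \<i> * s) * (of_real b + 1 + \<i> * s) * (of_real c + \<i> * s)
       / ((- 2 * \<i> * s) * (1 + 2 * \<i> * s)) * (g (s - \<i>) - g s)
   - of_real (b + c) * g s"

end

theory Submission
  imports Defs "HOL-Complex_Analysis.Complex_Analysis"
begin

text \<open>
  Write \<open>F\<^sub>s x\<close> for the kernel \<open>2F1 (b + i s, b - i s; b + c; - x)\<close> and \<open>w\<close> for the weight. Integrating
  by parts moves the derivative in the transform of \<open>x (x + 1) f'\<close> to the kernel and leaves the integral
  of \<open>f\<close> against \<open>- (x (x + 1) w F\<^sub>s)'\<close>. Dividing by \<open>w\<close>, the claim becomes a contiguous relation between
  \<open>F\<^sub>s\<close>, its derivative, and the kernels at \<open>s + i\<close> and \<open>s - i\<close>, which is checked on power series coefficients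
  and extended by analytic continuation. The integral obtained converges absolutely and is continuous
  at \<open>s = 0\<close>, which gives the limit there.

  Pfaff's transformation expresses \<open>F\<^sub>s x\<close> by a hypergeometric series in \<open>x / (1 + x)\<close>. Comparing its coefficients with those
  of a binomial series bounds the kernel by \<open>(1 + x) powr (\<sigma> - b)\<close>, locally uniformly in \<open>s\<close>, for
  every \<open>\<sigma> > \<bar>Im s\<bar>\<close>. The continuation of the Gauss function to the slit plane is Euler's integral when the
  real parts of its parameters are large enough; the other parameters are reached by differential operators that lower
  \<open>c\<close> or \<open>b\<close> by one.
\<close>

subsection \<open>Growth of hypergeometric coefficients\<close>

text \<open>Two obstacles shape the proof. The integral for \<open>x (x + 1) f'\<close> need not
  converge absolutely: the decay of \<open>f'\<close> makes its integrand only
  \<open>o(x^(\<sigma> - \<epsilon>))\<close>. Its convergence is therefore a result of the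
  integration by parts, not a prerequisite for it. The integration by parts costs one factor
  \<open>1 + x\<close>, so the new integral is controlled for
  \<open>\<bar>Im s\<bar> < \<epsilon>\<close>, while the integral of \<open>f\<close> is controlled
  for \<open>\<bar>Im s\<bar> < 1 + \<epsilon>\<close>; this difference is exactly the room that the
  shifts from real \<open>s\<close> to \<open>s + i\<close> and \<open>s - i\<close> require.
  Moreover, \<open>gauss_2F1\<close> is chosen separately for each triple of parameters, so its
  definition shows neither growth in \<open>x\<close> nor regularity in \<open>s\<close>; the Pfaff
  series supplies both. Its coefficients are estimated by comparing each Pochhammer symbol with
  \<open>n!\<close> times the exponential of a multiple of the harmonic number. This avoids
  asymptotics of the Gamma function and gives constants that depend only on bounds for the
  parameters, hence uniformity in \<open>s\<close>.\<close>

lemma sum_inverse_squares_le: "(\<Sum>k<n. 1 / (real k + 1)\<^sup>2) \<le> 2 - 1 / real n"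
proof (induction n)
  case (Suc n)
  \<comment> \<open>Telescoping. The step from 0 to 1 is separate: there \<open>1 / real 0\<close>
    is 0 by convention, and both sides equal 1 after it.\<close>
  have "1 / (real n + 1)\<^sup>2 \<le> 1 / real n - 1 / (real n + 1)" if "n > 0"
  proof -
    have "1 / (real n + 1)\<^sup>2 \<le> 1 / (real n * (real n + 1))"
      unfolding power2_eq_square using that by (intro divide_left_mono mult_right_mono mult_pos_pos) auto
    also have "\<dots> = 1 / real n - 1 / (real n + 1)"
      using that by (simp add: divide_simps)
    finally show ?thesis .
  qed
  then show ?case using Suc by (cases "n = 0") (auto simp: add_ac)
qed auto

text \<open>With \<open>u = a - 1\<close> and \<open>m = k + 1\<close>, the squared factor
  \<open>(norm (a + k) / m)^2\<close> is \<open>1 + 2 Re u / m + (norm u / m)^2\<close>, at most the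
  exponential of the added terms. Taking roots and multiplying, the first-order terms sum to the
  harmonic number and the second-order ones stay bounded.\<close>

lemma norm_pochhammer_le:
  fixes a :: complex
  shows "norm (pochhammer a n) \<le> fact n * exp (Re (a - 1) * harm n + (norm (a - 1))\<^sup>2)"
proof -
  define u where "u = a - 1"
  define S where "S n = (\<Sum>k<n. 1 / (real k + 1)\<^sup>2)" for n
  have step: "norm (a + of_nat k) \<le> (real k + 1) * exp (Re u / (real k + 1) + (norm u)\<^sup>2 / 2 * (1 / (real k + 1)\<^sup>2))" for k
  proof -
    have "(norm (a + of_nat k))\<^sup>2 = (real k + 1)\<^sup>2 + 2 * Re u * (real k + 1) + (norm u)\<^sup>2"
      unfolding u_def cmod_power2 by (simp add: power2_eq_square algebra_simps)
    also have "\<dots> = (real k + 1)\<^sup>2 * (1 + (2 * Re u / (real k + 1) + (norm u)\<^sup>2 / (real k + 1)\<^sup>2))"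
    proof -
      have "m\<^sup>2 + 2 * r * m + t = m\<^sup>2 * (1 + (2 * r / m + t / m\<^sup>2))" if "m > 0" for m r t :: real
        using that by (simp add: divide_simps power2_eq_square)
      then show ?thesis by simp
    qed
    also have "\<dots> \<le> (real k + 1)\<^sup>2 * exp (2 * Re u / (real k + 1) + (norm u)\<^sup>2 / (real k + 1)\<^sup>2)"
      by (intro mult_left_mono exp_ge_add_one_self) auto
    also have "\<dots> = ((real k + 1) * exp (Re u / (real k + 1) + (norm u)\<^sup>2 / 2 * (1 / (real k + 1)\<^sup>2)))\<^sup>2"
    proof -
      have "(m * exp y)\<^sup>2 = m\<^sup>2 * exp (2 * y)" for m y :: real
        by (simp add: power_mult_distrib exp_double)
      then show ?thesis by simp
    qed
    finally show ?thesis by (rule power2_le_imp_le) simp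
  qed
  have "norm (pochhammer a n) \<le> fact n * exp (Re u * harm n + (norm u)\<^sup>2 / 2 * S n)"
  proof (induction n)
    case (Suc n)
    have "norm (pochhammer a (Suc n)) = norm (pochhammer a n) * norm (a + of_nat n)"
      by (simp add: pochhammer_Suc norm_mult)
    also have "\<dots> \<le> (fact n * exp (Re u * harm n + (norm u)\<^sup>2 / 2 * S n))
      * ((real n + 1) * exp (Re u / (real n + 1) + (norm u)\<^sup>2 / 2 * (1 / (real n + 1)\<^sup>2)))"
      by (intro mult_mono Suc.IH step) auto
    also have "\<dots> = fact (Suc n) * exp (Re u * harm (Suc n) + (norm u)\<^sup>2 / 2 * S (Suc n))"
      unfolding exp_add distrib_left harm_Suc S_def lessThan_Suc
      by (simp add: exp_add distrib_left inverse_eq_divide add_ac)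
    finally show ?case .
  qed (auto simp: S_def harm_def)
  also have "\<dots> \<le> fact n * exp (Re u * harm n + (norm u)\<^sup>2)"
  proof -
    have "S n \<le> 2"
      unfolding S_def by (rule order_trans[OF sum_inverse_squares_le]) simp
    then have "(norm u)\<^sup>2 / 2 * S n \<le> (norm u)\<^sup>2 / 2 * 2" by (intro mult_left_mono) auto
    then show ?thesis by simp
  qed
  finally show ?thesis by (simp add: u_def)
qed

text \<open>The converse estimate, for denominators:
  \<open>(k + 1) / (v + k) = 1 + (1 - v) / (v + k)\<close>, again bounded by an exponential.
  Replacing \<open>v + k\<close> by \<open>k + 1\<close> costs a second-order error, summable
  because \<open>v + k\<close> is at least \<open>min v 1\<close> times
  \<open>k + 1\<close>.\<close>

lemma fact_le_pochhammer:
  fixes v :: real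
  assumes "v > 0"
  shows "fact n \<le> pochhammer v n * exp ((1 - v) * harm n + 2 * (1 - v)\<^sup>2 / min v 1)"
proof -
  define S where "S n = (\<Sum>k<n. 1 / (real k + 1)\<^sup>2)" for n
  define m where "m = min v 1"
  have m: "m > 0" "m \<le> v" "m \<le> 1" using assms by (auto simp: m_def)
  have step: "real k + 1 \<le> (v + real k) * exp ((1 - v) / (real k + 1) + (1 - v)\<^sup>2 / m * (1 / (real k + 1)\<^sup>2))" for k
  proof -
    have "m * (real k + 1) = m + m * real k" by (simp add: algebra_simps)
    also have "\<dots> \<le> v + 1 * real k" using m by (intro add_mono mult_right_mono) auto
    finally have le: "m * (real k + 1) \<le> v + real k" by simp
    have pos: "v + real k > 0" using assms by simp
    have "(1 - v) / (v + real k) = (1 - v) / (real k + 1) + (1 - v)\<^sup>2 / ((v + real k) * (real k + 1))"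
    proof -
      have "(q - p) / p = (q - p) / q + (q - p)\<^sup>2 / (p * q)" if "p > 0" "q > 0" for p q :: real
        using that by (simp add: divide_simps power2_eq_square) (simp add: algebra_simps)
      from this[OF pos, of "real k + 1"] show ?thesis by simp
    qed
    also have "(1 - v)\<^sup>2 / ((v + real k) * (real k + 1)) \<le> (1 - v)\<^sup>2 / ((m * (real k + 1)) * (real k + 1))"
      using pos m le by (intro divide_left_mono mult_right_mono mult_pos_pos) auto
    also have "\<dots> = (1 - v)\<^sup>2 / m * (1 / (real k + 1)\<^sup>2)" by (simp add: power2_eq_square)
    finally have e: "(1 - v) / (v + real k) \<le> (1 - v) / (real k + 1) + (1 - v)\<^sup>2 / m * (1 / (real k + 1)\<^sup>2)"
      by simp
    have "real k + 1 = (v + real k) * (1 + (1 - v) / (v + real k))"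
      using pos by (simp add: field_simps)
    also have "\<dots> \<le> (v + real k) * exp ((1 - v) / (v + real k))"
      using pos by (intro mult_left_mono exp_ge_add_one_self) auto
    also have "\<dots> \<le> (v + real k) * exp ((1 - v) / (real k + 1) + (1 - v)\<^sup>2 / m * (1 / (real k + 1)\<^sup>2))"
      using pos e by (intro mult_left_mono) auto
    finally show ?thesis .
  qed
  have "fact n \<le> pochhammer v n * exp ((1 - v) * harm n + (1 - v)\<^sup>2 / m * S n)"
  proof (induction n)
    case (Suc n)
    have "(fact (Suc n) :: real) = fact n * (real n + 1)" by simp
    also have "\<dots> \<le> (pochhammer v n * exp ((1 - v) * harm n + (1 - v)\<^sup>2 / m * S n))
       * ((v + real n) * exp ((1 - v) / (real n + 1) + (1 - v)\<^sup>2 / m * (1 / (real n + 1)\<^sup>2)))"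
      using assms by (intro mult_mono Suc.IH step mult_nonneg_nonneg pochhammer_nonneg) auto
    also have "\<dots> = pochhammer v (Suc n) * exp ((1 - v) * harm (Suc n) + (1 - v)\<^sup>2 / m * S (Suc n))"
      unfolding exp_add distrib_left harm_Suc S_def pochhammer_Suc lessThan_Suc
      by (simp add: exp_add distrib_left inverse_eq_divide add_ac)
    finally show ?case .
  qed (auto simp: S_def harm_def)
  also have "\<dots> \<le> pochhammer v n * exp ((1 - v) * harm n + 2 * (1 - v)\<^sup>2 / m)"
  proof -
    have "S n \<le> 2"
      unfolding S_def by (rule order_trans[OF sum_inverse_squares_le]) simp
    then have "(1 - v)\<^sup>2 / m * S n \<le> 2 * (1 - v)\<^sup>2 / m" using mult_left_mono[of "S n" 2 "(1 - v)\<^sup>2 / m"] using m by (simp add: mult.commute)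
    then show ?thesis using assms by (intro mult_left_mono pochhammer_nonneg) auto
  qed
  finally show ?thesis by (simp add: m_def)
qed

lemma norm_pochhammer_of_real:
  assumes "(c::real) > 0"
  shows "norm (pochhammer (complex_of_real c) n) = pochhammer c n"
proof -
  have "pochhammer (complex_of_real c) n = of_real (pochhammer c n)" by (simp add: pochhammer_of_real)
  then show ?thesis using pochhammer_nonneg[of c n] assms by simp
qed

lemma norm_hypergeo_nth_le:
  fixes c \<eta> R :: real
  assumes "c > 0" "\<eta> > 0"
  obtains K where "K > 0" "\<And>a b n. norm a \<le> R \<Longrightarrow> norm b \<le> R \<Longrightarrow> Re a + Re b - c \<le> \<eta> \<Longrightarrow>
    norm (fps_nth (fps_hypergeo [a, b] [complex_of_real c] 1) n) \<le> K * (pochhammer \<eta> n / fact n)"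
proof
  define Kc where "Kc v = 2 * (1 - v)\<^sup>2 / min v 1" for v :: real
  define K where "K = exp ((R + 1)\<^sup>2 + (R + 1)\<^sup>2 + Kc c + Kc \<eta>)"
  show "K > 0" by (simp add: K_def)
  fix a b :: complex and n :: nat
  assume ab: "norm a \<le> R" "norm b \<le> R" "Re a + Re b - c \<le> \<eta>"
  have h: "(harm n :: real) \<ge> 0" by (rule harm_nonneg)
  have sq: "(norm (u - 1))\<^sup>2 \<le> (R + 1)\<^sup>2" if "norm u \<le> R" for u :: complex
    using that norm_triangle_ineq4[of u 1] by (intro power_mono) auto
  define A B where "A = exp (Re (a - 1) * harm n + (R + 1)\<^sup>2)" and "B = exp (Re (b - 1) * harm n + (R + 1)\<^sup>2)"
  have a: "norm (pochhammer a n) \<le> fact n * A"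
    unfolding A_def using sq[OF ab(1)]
    by (intro order_trans[OF norm_pochhammer_le] mult_left_mono) auto
  have b: "norm (pochhammer b n) \<le> fact n * B"
    unfolding B_def using sq[OF ab(2)]
    by (intro order_trans[OF norm_pochhammer_le] mult_left_mono) auto
  define E where "E v = exp ((1 - v) * harm n + Kc v)" for v
  have c: "fact n \<le> pochhammer c n * E c"
    unfolding E_def Kc_def using assms by (intro fact_le_pochhammer)
  have e: "fact n \<le> pochhammer \<eta> n * E \<eta>"
    unfolding E_def Kc_def using assms by (intro fact_le_pochhammer)
  have pc: "pochhammer c n > 0" "pochhammer \<eta> n > 0" using assms by (auto intro: pochhammer_pos)
  have "norm (fps_nth (fps_hypergeo [a, b] [complex_of_real c] 1) n)
      = norm (pochhammer a n) * norm (pochhammer b n) / (pochhammer c n * fact n)"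
    using assms by (simp add: norm_mult norm_divide norm_pochhammer_of_real)
  also have "\<dots> \<le> (fact n * A) * (fact n * B) / (pochhammer c n * fact n)"
    using pc by (intro divide_right_mono mult_mono a b) (auto simp: A_def)
  also have "\<dots> = A * B * (fact n / pochhammer c n)" using pc by (simp add: field_simps)
  also have "\<dots> \<le> A * B * E c"
    using c pc by (intro mult_left_mono) (auto simp: A_def B_def field_simps)
  \<comment> \<open>The comparison coefficient is inserted as a factor that is at least 1; its
    exponential \<open>E \<eta>\<close> contributes the term \<open>- \<eta>\<close> to the
    exponent.\<close>
  also have "\<dots> \<le> A * B * E c * (pochhammer \<eta> n * E \<eta> / fact n)"
  proof -
    have "1 \<le> pochhammer \<eta> n * E \<eta> / fact n" using e by (simp add: field_simps)
    moreover have "A * B * E c \<ge> 0" by (simp add: A_def B_def E_def)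
    ultimately show ?thesis using mult_left_mono[of 1 "pochhammer \<eta> n * E \<eta> / fact n" "A * B * E c"] by simp
  qed
  also have "\<dots> = (A * B * E c * E \<eta>) * (pochhammer \<eta> n / fact n)" by simp
  also have "A * B * E c * E \<eta> = exp ((Re a + Re b - c - \<eta>) * harm n + ((R + 1)\<^sup>2 + (R + 1)\<^sup>2 + Kc c + Kc \<eta>))"
    unfolding A_def B_def E_def exp_add[symmetric] by (simp add: algebra_simps)
  finally have le: "norm (fps_nth (fps_hypergeo [a, b] [complex_of_real c] 1) n)
      \<le> exp ((Re a + Re b - c - \<eta>) * harm n + ((R + 1)\<^sup>2 + (R + 1)\<^sup>2 + Kc c + Kc \<eta>)) * (pochhammer \<eta> n / fact n)" .
  have "exp ((Re a + Re b - c - \<eta>) * harm n + ((R + 1)\<^sup>2 + (R + 1)\<^sup>2 + Kc c + Kc \<eta>)) \<le> K"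
    unfolding K_def using ab(3) h by (simp add: mult_nonpos_nonneg)
  then show "norm (fps_nth (fps_hypergeo [a, b] [complex_of_real c] 1) n) \<le> K * (pochhammer \<eta> n / fact n)"
    using pc by (intro order_trans[OF le] mult_right_mono) auto
qed

lemma sums_neg_binomial:
  fixes w \<eta> :: real
  assumes "\<bar>w\<bar> < 1"
  shows "(\<lambda>n. pochhammer \<eta> n / fact n * w ^ n) sums (1 - w) powr (- \<eta>)"
proof -
  have "(\<lambda>n. ((-\<eta>) gchoose n) * (-w) ^ n) sums (1 + (-w)) powr (-\<eta>)"
    using assms by (intro gen_binomial_real) auto
  moreover have "((-\<eta>) gchoose n) * (-w) ^ n = pochhammer \<eta> n / fact n * w ^ n" for n
    by (cases "even n") (auto simp: gbinomial_pochhammer)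
  ultimately show ?thesis by simp
qed

lemma conv_radius_hypergeo:
  assumes "c > 0"
  shows "fps_conv_radius (fps_hypergeo [a, b] [complex_of_real c] 1) \<ge> 1"
proof -
  define \<eta> where "\<eta> = max 1 (Re a + Re b - c)"
  obtain K where K: "\<And>n. norm (fps_nth (fps_hypergeo [a, b] [complex_of_real c] 1) n) \<le> K * (pochhammer \<eta> n / fact n)"
  proof (rule norm_hypergeo_nth_le[of c \<eta> "max (norm a) (norm b)"])
    show "c > 0" "\<eta> > 0" using assms by (auto simp: \<eta>_def)
    fix K
    assume *: "\<And>a' b' n. norm a' \<le> max (norm a) (norm b) \<Longrightarrow> norm b' \<le> max (norm a) (norm b) \<Longrightarrow> Re a' + Re b' - c \<le> \<eta> \<Longrightarrow>
      norm (fps_nth (fps_hypergeo [a', b'] [complex_of_real c] 1) n) \<le> K * (pochhammer \<eta> n / fact n)"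
    show thesis
      by (rule that, rule *) (auto simp: \<eta>_def)
  qed
  show ?thesis
    unfolding fps_conv_radius_def one_ereal_def
  proof (rule conv_radius_geI_ex)
    fix r :: real assume r: "0 < r" "ereal r < ereal 1"
    have "summable (\<lambda>n. K * (pochhammer \<eta> n / fact n * r ^ n))"
      using r by (intro summable_mult sums_summable[OF sums_neg_binomial]) auto
    then have "summable (\<lambda>n. fps_nth (fps_hypergeo [a, b] [complex_of_real c] 1) n * of_real r ^ n)"
    proof (rule summable_comparison_test'[where N = 0])
      fix n
      show "norm (fps_nth (fps_hypergeo [a, b] [complex_of_real c] 1) n * of_real r ^ n) \<le> K * (pochhammer \<eta> n / fact n * r ^ n)"
        unfolding norm_mult norm_power using mult_right_mono[OF K, of "r ^ n" n] r by (simp add: mult_ac)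
    qed
    then show "\<exists>z. norm z = r \<and> summable (\<lambda>n. fps_nth (fps_hypergeo [a, b] [complex_of_real c] 1) n * z ^ n)"
      using r by (intro exI[of _ "of_real r"]) auto
  qed
qed

lemma norm_eval_hypergeo_le:
  fixes w :: complex
  assumes "c > 0" "norm w < 1"
    and K: "\<And>n. norm (fps_nth (fps_hypergeo [a, b] [complex_of_real c] 1) n) \<le> K * (pochhammer \<eta> n / fact n)"
  shows "norm (eval_fps (fps_hypergeo [a, b] [complex_of_real c] 1) w) \<le> K * (1 - norm w) powr (- \<eta>)"
proof -
  have s: "(\<lambda>n. K * (pochhammer \<eta> n / fact n * norm w ^ n)) sums (K * (1 - norm w) powr (- \<eta>))"
    using assms by (intro sums_mult sums_neg_binomial) auto
  show ?thesis
    unfolding eval_fps_def sums_unique[OF s] 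
  proof (rule norm_suminf_le[OF _ sums_summable[OF s]])
    fix n
    show "norm (fps_nth (fps_hypergeo [a, b] [complex_of_real c] 1) n * w ^ n) \<le> K * (pochhammer \<eta> n / fact n * norm w ^ n)"
      unfolding norm_mult norm_power using mult_right_mono[OF K, of "norm w ^ n" n] by (simp add: mult_ac)
  qed
qed

subsection \<open>Continuation to the slit plane\<close>

lemma slit_plane_iff: "z \<in> slit_plane \<longleftrightarrow> \<not> (Im z = 0 \<and> Re z \<ge> 1)"
  by (auto simp: slit_plane_def complex_eq_iff image_iff intro!: bexI[of _ "Re z"])

lemma open_slit_plane [intro]: "open slit_plane"
proof -
  have "slit_plane = - ({z. Im z \<le> 0} \<inter> {z. Im z \<ge> 0} \<inter> {z. Re z \<ge> 1})"
    by (auto simp: slit_plane_iff)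
  also have "open \<dots>"
    by (intro open_Compl closed_Int closed_halfspace_Re_ge closed_halfspace_Im_le closed_halfspace_Im_ge)
  finally show ?thesis .
qed

text \<open>This keeps the principal power of \<open>1 - z t\<close> in Euler's integral off its
  branch cut. The same fact shows that the slit plane is starlike about 0.\<close>

lemma one_minus_mult_notin_nonpos_Reals:
  assumes "z \<in> slit_plane" "0 \<le> t" "t \<le> 1"
  shows "1 - z * of_real t \<notin> \<real>\<^sub>\<le>\<^sub>0"
proof
  assume "1 - z * of_real t \<in> \<real>\<^sub>\<le>\<^sub>0"
  then have *: "Im z * t = 0" "Re z * t \<ge> 1"
    by (auto simp: complex_nonpos_Reals_iff)
  then have "t > 0" using assms(2) by (cases "t = 0") auto
  moreover from this have "Im z = 0" using * by simp
  moreover have "Re z \<ge> 1"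
  proof (rule ccontr)
    assume "\<not> Re z \<ge> 1"
    then have "Re z * t < 1 * t" using \<open>t > 0\<close> by (intro mult_strict_right_mono) auto
    then show False using * assms(3) by simp
  qed
  ultimately show False using assms(1) by (simp add: slit_plane_iff)
qed

lemma connected_slit_plane [intro]: "connected slit_plane"
proof -
  have "starlike slit_plane"
    unfolding starlike_def
  proof (intro bexI ballI subsetI)
    fix z w assume z: "z \<in> slit_plane" and w: "w \<in> closed_segment 0 z"
    then obtain t where t: "w = of_real t * z" "0 \<le> t" "t \<le> 1"
      by (auto simp: closed_segment_def scaleR_conv_of_real)
    show "w \<in> slit_plane"
      using one_minus_mult_notin_nonpos_Reals[OF z t(2,3)] t(1)
      by (auto simp: slit_plane_iff complex_nonpos_Reals_iff mult.commute)
  qed (simp add: slit_plane_iff)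
  then show ?thesis by (rule starlike_imp_connected)
qed

lemma zero_in_slit_plane [simp]: "0 \<in> slit_plane"
  by (simp add: slit_plane_iff)

lemma neg_of_real_in_slit_plane [simp]: "x \<ge> 0 \<Longrightarrow> - complex_of_real x \<in> slit_plane"
  by (simp add: slit_plane_iff)

lemma ball_subset_slit_plane: "ball 0 1 \<subseteq> slit_plane"
proof
  fix z :: complex assume "z \<in> ball 0 1"
  then show "z \<in> slit_plane"
    using complex_Re_le_cmod[of z] by (auto simp: slit_plane_iff)
qed

text \<open>By Weierstrass approximation: \<open>u\<close> is orthogonal to all polynomials, so the
  integral of \<open>u^2\<close> equals that of \<open>(u - p) u\<close> for every polynomial
  \<open>p\<close>, which can be made arbitrarily small.\<close>

lemma continuous_zero_of_moments_zero:
  fixes u :: "real \<Rightarrow> real"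
  assumes cont: "continuous_on {0..1} u"
    and mom: "\<And>n. integral {0..1} (\<lambda>t. t ^ n * u t) = 0"
    and t: "t \<in> {0..1}"
  shows "u t = 0"
proof -
  have int_poly: "integral {0..1} (\<lambda>t. p t * u t) = 0" if p: "real_polynomial_function p" for p
  proof -
    obtain a n where p: "p = (\<lambda>x. \<Sum>i\<le>n. a i * x ^ i)"
      using p unfolding real_polynomial_function_iff_sum by blast
    have "integral {0..1} (\<lambda>t. p t * u t) = integral {0..1} (\<lambda>t. \<Sum>i\<le>n. a i * (t ^ i * u t))"
      by (simp add: p sum_distrib_right mult.assoc)
    also have "\<dots> = (\<Sum>i\<le>n. integral {0..1} (\<lambda>t. a i * (t ^ i * u t)))"
      by (intro integral_sum integrable_continuous_real continuous_intros cont) auto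
    also have "\<dots> = 0" using mom by simp
    finally show ?thesis .
  qed
  have "integral {0..1} (\<lambda>t. u t * u t) = 0"
  proof -
    have "\<bar>integral {0..1} (\<lambda>t. u t * u t)\<bar> \<le> e" if e: "e > 0" for e
    proof -
      have "bounded (u ` {0..1})"
        by (intro compact_imp_bounded compact_continuous_image cont) auto
      then obtain M where M: "\<And>t. t \<in> {0..1} \<Longrightarrow> \<bar>u t\<bar> \<le> M" "M > 0"
        unfolding bounded_pos by force
      obtain p where p: "real_polynomial_function p" "\<And>t. t \<in> {0..1} \<Longrightarrow> \<bar>u t - p t\<bar> < e / M"
        using Stone_Weierstrass_real_polynomial_function[of "{0..1}" u "e / M"] cont e M(2) by auto
      have "continuous_on {0..1} p"
        using continuous_real_polymonial_function[OF p(1)] by (intro continuous_at_imp_continuous_on) auto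
      then have "integral {0..1} (\<lambda>t. (u t - p t) * u t) = integral {0..1} (\<lambda>t. u t * u t) - integral {0..1} (\<lambda>t. p t * u t)"
        unfolding left_diff_distrib
        by (intro integral_diff integrable_continuous_real continuous_intros cont)
      then have "integral {0..1} (\<lambda>t. u t * u t) = integral {0..1} (\<lambda>t. (u t - p t) * u t)"
        using int_poly[OF p(1)] by simp
      also have "norm \<dots> \<le> integral {0..1} (\<lambda>t::real. e)"
      proof (intro integral_norm_bound_integral integrable_continuous_real continuous_intros cont \<open>continuous_on {0..1} p\<close>)
        fix t :: real assume "t \<in> {0..1}"
        then have "\<bar>u t - p t\<bar> * \<bar>u t\<bar> \<le> e / M * M"
          using p(2)[of t] M(1)[of t] M(2) e by (intro mult_mono) auto
        then show "norm ((u t - p t) * u t) \<le> e"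
          using M(2) by (simp add: abs_mult)
      qed
      finally show ?thesis by simp
    qed
    then show ?thesis by (meson abs_le_zero_iff dense_ge le_less)
  qed
  then have "u t * u t = 0"
    using t by (subst (asm) integral_eq_0_iff) (auto intro!: continuous_intros cont)
  then show ?thesis by simp
qed

section \<open>Euler's integral and its moments\<close>

definition euler_weight :: "complex \<Rightarrow> real \<Rightarrow> real \<Rightarrow> complex" where
  "euler_weight b c t = of_real t powr (b - 1) * of_real (1 - t) powr (of_real c - b - 1)"

text \<open>Both exponents have positive real part, so the weight extends continuously by 0 to the
  endpoints, and no singular integrals occur below.\<close>

lemma continuous_euler_weight:
  assumes "Re b > 1" "c - Re b > 1"
  shows "continuous_on {0..1} (euler_weight b c)"
  unfolding euler_weight_def
  using assms by (intro continuous_intros) auto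

text \<open>Integrate the derivative of \<open>t^(n+1) (1 - t)\<close> times the weight, a function
  that vanishes at 0 and at 1.\<close>

lemma euler_weight_moment_Suc:
  assumes "Re b > 1" "c - Re b > 1"
  shows "(of_real c + of_nat n) * integral {0..1} (\<lambda>t. of_real t ^ Suc n * euler_weight b c t) =
         (b + of_nat n) * integral {0..1} (\<lambda>t. of_real t ^ n * euler_weight b c t)"
proof -
  note cont = continuous_euler_weight[OF assms]
  let ?\<phi> = "euler_weight b c"
  define G where "G t = of_real t ^ Suc n * of_real (1 - t) * ?\<phi> t" for t
  define G' where "G' t = (b + of_nat n) * (of_real t ^ n * ?\<phi> t) - (of_real c + of_nat n) * (of_real t ^ Suc n * ?\<phi> t)" for t
  have "(G' has_integral (G 1 - G 0)) {0..1}"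
  proof (rule fundamental_theorem_of_calculus_interior)
    show "continuous_on {0..1} G" unfolding G_def by (intro continuous_intros cont)
    fix t :: real assume t: "t \<in> {0<..<1}"
    have "(G has_vector_derivative
       (of_nat (Suc n) * of_real t ^ n * of_real (1 - t) - of_real t ^ Suc n) * ?\<phi> t
       + of_real t ^ Suc n * of_real (1 - t) * 
       ((b - 1) * of_real t powr (b - 1 - 1) * of_real (1 - t) powr (of_real c - b - 1)
       - of_real t powr (b - 1) * ((of_real c - b - 1) * of_real (1 - t) powr (of_real c - b - 1 - 1)))) (at t)"
    proof -
      \<comment> \<open>Differentiation is done for a complex variable and then restricted to the
        real line, since the exponents are complex.\<close>
      let ?g = "\<lambda>z::complex. z ^ Suc n * (1 - z) * (z powr (b - 1) * (1 - z) powr (of_real c - b - 1))"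
      have "complex_of_real t \<notin> \<real>\<^sub>\<le>\<^sub>0" "1 - complex_of_real t \<notin> \<real>\<^sub>\<le>\<^sub>0"
        using t by (auto simp: complex_nonpos_Reals_iff)
      then have "(?g has_field_derivative
         (of_nat (Suc n) * of_real t ^ n * (1 - of_real t) - of_real t ^ Suc n) * (of_real t powr (b - 1) * (1 - of_real t) powr (of_real c - b - 1))
         + of_real t ^ Suc n * (1 - of_real t) *
         ((b - 1) * of_real t powr (b - 1 - 1) * (1 - of_real t) powr (of_real c - b - 1)
         - of_real t powr (b - 1) * ((of_real c - b - 1) * (1 - of_real t) powr (of_real c - b - 1 - 1)))) (at (of_real t))"
        by (auto intro!: derivative_eq_intros simp: algebra_simps simp del: power_Suc)
      from has_vector_derivative_real_field[OF this] show ?thesis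
        unfolding G_def euler_weight_def by (simp add: o_def)
    qed
    also have "(of_nat (Suc n) * of_real t ^ n * of_real (1 - t) - of_real t ^ Suc n) * ?\<phi> t
       + of_real t ^ Suc n * of_real (1 - t) * 
       ((b - 1) * of_real t powr (b - 1 - 1) * of_real (1 - t) powr (of_real c - b - 1)
       - of_real t powr (b - 1) * ((of_real c - b - 1) * of_real (1 - t) powr (of_real c - b - 1 - 1))) = G' t"
    proof -
      have base: "z powr w = z * z powr (w - 1)" if "z \<noteq> 0" for z w :: complex
        using that by (simp add: powr_def left_diff_distrib exp_diff)
      have 1: "complex_of_real t powr (b - 1) = of_real t * complex_of_real t powr (b - 1 - 1)"
        using t by (intro base) auto
      have 2: "complex_of_real (1 - t) powr (of_real c - b - 1) = of_real (1 - t) * complex_of_real (1 - t) powr (of_real c - b - 1 - 1)"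
        using t by (intro base) auto
      show ?thesis
        unfolding G'_def euler_weight_def 1 2 unfolding power_Suc of_nat_Suc of_real_diff of_real_1
        by (simp add: algebra_simps)
    qed
    finally show "(G has_vector_derivative G' t) (at t)" .
  qed simp
  then have "integral {0..1} G' = 0"
    by (auto simp: G_def has_integral_iff)
  moreover have "integral {0..1} G' = (b + of_nat n) * integral {0..1} (\<lambda>t. of_real t ^ n * ?\<phi> t)
      - (of_real c + of_nat n) * integral {0..1} (\<lambda>t. of_real t ^ Suc n * ?\<phi> t)"
    unfolding G'_def
    by (subst integral_diff) (auto intro!: integrable_continuous_real continuous_intros cont)
  ultimately show ?thesis by simp
qed

lemma euler_weight_moment:
  assumes "Re b > 1" "c - Re b > 1"
  shows "integral {0..1} (\<lambda>t. of_real t ^ n * euler_weight b c t) =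
         pochhammer b n / pochhammer (of_real c) n * integral {0..1} (euler_weight b c)"
proof (induction n)
  case (Suc n)
  have "of_real c + of_nat n \<noteq> (0::complex)"
    using assms by (auto simp: complex_eq_iff)
  then have "integral {0..1} (\<lambda>t. of_real t ^ Suc n * euler_weight b c t) =
      (b + of_nat n) / (of_real c + of_nat n) * integral {0..1} (\<lambda>t. of_real t ^ n * euler_weight b c t)"
    using euler_weight_moment_Suc[OF assms, of n] by (simp add: field_simps)
  then show ?case unfolding Suc.IH pochhammer_Suc by (simp add: mult_ac)
qed simp

text \<open>A nonvanishing proof that does not evaluate the Beta function: if the integral were 0,
  the recurrence would annihilate every moment, hence the real and imaginary parts of the weight,
  which is not 0 at \<open>1/2\<close>.\<close>

lemma euler_weight_integral_nonzero:
  assumes "Re b > 1" "c - Re b > 1"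
  shows "integral {0..1} (euler_weight b c) \<noteq> 0"
proof
  assume 0: "integral {0..1} (euler_weight b c) = 0"
  note cont = continuous_euler_weight[OF assms]
  have mom: "((\<lambda>t. of_real t ^ n * euler_weight b c t) has_integral 0) {0..1}" for n
  proof -
    have "(\<lambda>t. of_real t ^ n * euler_weight b c t) integrable_on {0..1}"
      by (intro integrable_continuous_real continuous_intros cont)
    then show ?thesis using euler_weight_moment[OF assms, of n] 0 by (simp add: has_integral_iff)
  qed
  have "Re (euler_weight b c (1/2)) = 0"
  proof (rule continuous_zero_of_moments_zero[of "\<lambda>t. Re (euler_weight b c t)" "1/2"])
    show "integral {0..1} (\<lambda>t. t ^ n * Re (euler_weight b c t)) = 0" for n
      using has_integral_Re[OF mom[of n]] by (simp add: has_integral_iff flip: of_real_power)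
  qed (auto intro!: continuous_intros cont)
  moreover have "Im (euler_weight b c (1/2)) = 0"
  proof (rule continuous_zero_of_moments_zero[of "\<lambda>t. Im (euler_weight b c t)" "1/2"])
    show "integral {0..1} (\<lambda>t. t ^ n * Im (euler_weight b c t)) = 0" for n
      using has_integral_Im[OF mom[of n]] by (simp add: has_integral_iff flip: of_real_power)
  qed (auto intro!: continuous_intros cont)
  ultimately have "euler_weight b c (1/2) = 0" by (simp add: complex_eq_iff)
  then show False by (simp add: euler_weight_def powr_def)
qed

text \<open>The factor \<open>t^j\<close> closes the family under differentiation: each derivative
  in \<open>z\<close> raises the exponent \<open>a\<close> by one and brings down one more
  \<open>t\<close>.\<close>

definition euler_integral :: "complex \<Rightarrow> complex \<Rightarrow> real \<Rightarrow> nat \<Rightarrow> complex \<Rightarrow> complex" where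
  "euler_integral a b c j z =
     integral {0..1} (\<lambda>t. (1 - z * of_real t) powr (- a) * (of_real t ^ j * euler_weight b c t))"

lemma has_field_derivative_euler_integral:
  assumes bc: "Re b > 1" "c - Re b > 1" and z: "z \<in> slit_plane"
  shows "(euler_integral a b c j has_field_derivative a * euler_integral (a + 1) b c (Suc j) z) (at z)"
proof -
  obtain r where r: "r > 0" "ball z r \<subseteq> slit_plane"
    using z open_slit_plane open_contains_ball by blast
  note cont = continuous_euler_weight[OF bc]
  have notin: "1 - w * of_real t \<notin> \<real>\<^sub>\<le>\<^sub>0" if "w \<in> ball z r" "t \<in> {0..1}" for w t
    using one_minus_mult_notin_nonpos_Reals[of w t] r that by auto
  \<comment> \<open>General \<open>p\<close> and \<open>k\<close>, because joint continuity is used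
    both for the integrand and for its derivative in \<open>w\<close>.\<close>
  have cont2: "continuous_on (ball z r \<times> {0..1}) (\<lambda>(w, t). (1 - w * of_real t) powr p * (of_real t ^ k * euler_weight b c t))" for p k
    unfolding split_beta
  proof (intro continuous_on_mult continuous_on_compose2[OF cont] continuous_on_powr_complex)
    show "ball z r \<times> {0..1} \<subseteq> {x. 0 \<le> Re (1 - fst x * of_real (snd x)) \<or> Im (1 - fst x * of_real (snd x)) \<noteq> 0}"
      using notin by (force simp: complex_nonpos_Reals_iff)
    fix x :: "complex \<times> real" assume "x \<in> ball z r \<times> {0..1}" "1 - fst x * of_real (snd x) = 0"
    then show "Re p > 0" using notin[of "fst x" "snd x"] by auto
  qed (auto intro!: continuous_intros)
  have "((\<lambda>w. integral (cbox 0 1) (\<lambda>t. (1 - w * of_real t) powr (- a) * (of_real t ^ j * euler_weight b c t)))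
     has_field_derivative integral (cbox 0 1) (\<lambda>t. a * ((1 - z * of_real t) powr (- (a + 1)) * (of_real t ^ Suc j * euler_weight b c t)))) (at z within ball z r)"
  proof (rule leibniz_rule_field_derivative)
    fix w t assume w: "w \<in> ball z r" and t: "t \<in> cbox (0::real) 1"
    have "((\<lambda>w. (1 - w * of_real t) powr (- a)) has_field_derivative
       (- a) * (1 - w * of_real t) powr (- a - 1) * (- of_real t)) (at w within ball z r)"
      using notin[OF w, of t] t by (auto intro!: derivative_eq_intros)
    from DERIV_cmult_right[OF this, of "of_real t ^ j * euler_weight b c t"]
    show "((\<lambda>w. (1 - w * of_real t) powr (- a) * (of_real t ^ j * euler_weight b c t)) has_field_derivative
      a * ((1 - w * of_real t) powr (- (a + 1)) * (of_real t ^ Suc j * euler_weight b c t))) (at w within ball z r)"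
      by (simp add: mult_ac)
  next
    fix w assume w: "w \<in> ball z r"
    show "(\<lambda>t. (1 - w * of_real t) powr (- a) * (of_real t ^ j * euler_weight b c t)) integrable_on cbox 0 1"
    proof (rule integrable_continuous)
      have "continuous_on {0..1} ((\<lambda>(w, t). (1 - w * of_real t) powr (- a) * (of_real t ^ j * euler_weight b c t)) \<circ> Pair w)"
        using w by (intro continuous_on_compose continuous_on_subset[OF cont2] continuous_intros) auto
      then show "continuous_on (cbox 0 1) (\<lambda>t. (1 - w * of_real t) powr (- a) * (of_real t ^ j * euler_weight b c t))"
        by (simp add: o_def)
    qed
  next
    show "continuous_on (ball z r \<times> cbox 0 1) (\<lambda>(w, t). a * ((1 - w * of_real t) powr (- (a + 1)) * (of_real t ^ Suc j * euler_weight b c t)))"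
      using continuous_on_mult[OF continuous_on_const[of _ a] cont2[of "- (a + 1)" "Suc j"]]
      by (simp add: split_beta)
  qed (use r in auto)
  then show ?thesis
    using r by (simp add: at_within_open[of _ "ball z r"] euler_integral_def[abs_def])
qed

lemma higher_deriv_euler_integral:
  assumes bc: "Re b > 1" "c - Re b > 1" and z: "z \<in> slit_plane"
  shows "(deriv ^^ n) (euler_integral a b c 0) z = pochhammer a n * euler_integral (a + of_nat n) b c n z"
  using z
proof (induction n arbitrary: z)
  case (Suc n)
  have "(deriv ^^ Suc n) (euler_integral a b c 0) z = deriv ((deriv ^^ n) (euler_integral a b c 0)) z" by simp
  also have "\<dots> = deriv (\<lambda>z. pochhammer a n * euler_integral (a + of_nat n) b c n z) z"
  proof (rule deriv_cong_ev[OF _ refl])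
    show "\<forall>\<^sub>F z in nhds z. (deriv ^^ n) (euler_integral a b c 0) z = pochhammer a n * euler_integral (a + of_nat n) b c n z"
      using eventually_nhds_in_open[OF open_slit_plane Suc.prems] by eventually_elim (rule Suc.IH)
  qed
  also have "\<dots> = pochhammer a n * ((a + of_nat n) * euler_integral (a + of_nat n + 1) b c (Suc n) z)"
    by (intro DERIV_imp_deriv DERIV_cmult has_field_derivative_euler_integral bc Suc.prems)
  finally show ?case by (simp add: pochhammer_Suc add_ac mult_ac)
qed simp

text \<open>Unlike the definition of \<^const>\<open>gauss_2F1\<close>, stated with an expansion at the origin, so that identities
  between such functions reduce to identities between formal power series.\<close>
definition gauss_continuation :: "complex \<Rightarrow> complex \<Rightarrow> real \<Rightarrow> (complex \<Rightarrow> complex) \<Rightarrow> bool" where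
  "gauss_continuation a b c F \<longleftrightarrow>
     F holomorphic_on slit_plane \<and> F has_fps_expansion fps_hypergeo [a, b] [of_real c] 1"

text \<open>At \<open>z = 0\<close> the derivatives of Euler's integral are moments of the weight.
  Dividing by the zeroth moment \<open>m\<close> gives the hypergeometric coefficients.\<close>

lemma gauss_continuation_euler:
  assumes bc: "Re b > 1" "c - Re b > 1"
  shows "\<exists>F. gauss_continuation a b c F"
proof -
  define m where "m = integral {0..1} (euler_weight b c)"
  have m: "m \<noteq> 0" using euler_weight_integral_nonzero[OF bc] by (simp add: m_def)
  let ?E = "euler_integral a b c 0"
  have hol: "?E holomorphic_on slit_plane"
    using has_field_derivative_euler_integral[OF bc] holomorphic_on_open[OF open_slit_plane] by blast
  then have "?E has_fps_expansion fps_expansion ?E 0"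
    by (intro has_fps_expansion_fps_expansion[of slit_plane]) auto
  then have "(\<lambda>z. inverse m * ?E z) has_fps_expansion fps_const (inverse m) * fps_expansion ?E 0"
    by (intro fps_expansion_intros)
  also have "fps_const (inverse m) * fps_expansion ?E 0 = fps_hypergeo [a, b] [of_real c] 1"
  proof (rule fps_ext)
    fix n
    have "(deriv ^^ n) ?E 0 = pochhammer a n * euler_integral (a + of_nat n) b c n 0"
      by (rule higher_deriv_euler_integral[OF bc]) simp
    also have "euler_integral (a + of_nat n) b c n 0 = pochhammer b n / pochhammer (of_real c) n * m"
      unfolding euler_integral_def using euler_weight_moment[OF bc, of n] by (simp add: m_def)
    finally show "fps_nth (fps_const (inverse m) * fps_expansion ?E 0) n = fps_nth (fps_hypergeo [a, b] [of_real c] 1) n"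
      using m by (simp add: fps_expansion_def field_simps)
  qed
  finally show ?thesis
    unfolding gauss_continuation_def using hol by (intro exI[of _ "\<lambda>z. inverse m * ?E z"] conjI) (auto intro!: holomorphic_intros)
qed

lemma pochhammer_of_real_neq_0:
  assumes "c > 0"
  shows "pochhammer (complex_of_real c) n \<noteq> 0"
  using norm_pochhammer_of_real[OF assms, of n] pochhammer_pos[OF assms, of n] by auto

section \<open>Operators that lower the parameters\<close>

lemma fps_nth_X_mult_deriv: "fps_nth (fps_X * fps_deriv H) n = of_nat n * fps_nth (H :: 'a :: comm_semiring_1 fps) n"
  by (cases n) auto

text \<open>Coefficientwise this is \<open>1 / (c)_n = (1 + n / c) / (c + 1)_n\<close>, where
  multiplication by \<open>n\<close> is the Euler operator \<open>X d/dX\<close>.\<close>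

lemma fps_hypergeo_lower_denominator:
  assumes "c > 0"
  shows "fps_hypergeo [a, b] [complex_of_real c] 1 = fps_hypergeo [a, b] [of_real (c + 1)] 1
     + fps_const (1 / of_real c) * (fps_X * fps_deriv (fps_hypergeo [a, b] [of_real (c + 1)] 1))"
proof (rule fps_ext)
  fix n
  have nz: "complex_of_real c \<noteq> 0" "complex_of_real c + of_nat k \<noteq> 0" for k
    using assms by (auto simp: complex_eq_iff)
  have "pochhammer (complex_of_real c + 1) n \<noteq> 0" "pochhammer (complex_of_real c) n \<noteq> 0"
    using pochhammer_of_real_neq_0[of "c + 1" n] pochhammer_of_real_neq_0[of c n] assms by auto
  moreover have "of_real c * pochhammer (complex_of_real c + 1) n = pochhammer (of_real c) n * (of_real c + of_nat n)"
    by (metis pochhammer_Suc pochhammer_rec)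
  ultimately have "1 / pochhammer (complex_of_real c) n = (of_real c + of_nat n) / (of_real c * pochhammer (complex_of_real c + 1) n)"
    using nz(1) nz(2)[of n] by (subst frac_eq_eq) (simp_all add: mult.commute)
  also have "\<dots> = 1 / pochhammer (complex_of_real c + 1) n * (1 + of_nat n / of_real c)"
    using nz(1) by (simp add: add_divide_distrib)
  finally have *: "1 / pochhammer (complex_of_real c) n = 1 / pochhammer (complex_of_real c + 1) n * (1 + of_nat n / of_real c)" .
  define X where "X = pochhammer a n * pochhammer b n / fact n"
  have "fps_nth (fps_hypergeo [a, b] [complex_of_real c] 1) n = 1 / pochhammer (complex_of_real c) n * X"
    by (simp add: X_def)
  also have "\<dots> = 1 / pochhammer (complex_of_real c + 1) n * X
     + 1 / of_real c * (of_nat n * (1 / pochhammer (complex_of_real c + 1) n * X))"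
    unfolding * by (simp add: algebra_simps add_divide_distrib)
  also have "\<dots> = fps_nth (fps_hypergeo [a, b] [of_real (c + 1)] 1
     + fps_const (1 / of_real c) * (fps_X * fps_deriv (fps_hypergeo [a, b] [of_real (c + 1)] 1))) n"
    unfolding fps_add_nth fps_mult_left_const_nth fps_nth_X_mult_deriv by (simp add: X_def)
  finally show "fps_nth (fps_hypergeo [a, b] [complex_of_real c] 1) n = fps_nth (fps_hypergeo [a, b] [of_real (c + 1)] 1
     + fps_const (1 / of_real c) * (fps_X * fps_deriv (fps_hypergeo [a, b] [of_real (c + 1)] 1))) n" .
qed

lemma gauss_continuation_lower_denominator:
  assumes "c > 0" "gauss_continuation a b (c + 1) F"
  shows "\<exists>G. gauss_continuation a b c G"
proof (intro exI, unfold gauss_continuation_def, intro conjI)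
  have F: "F holomorphic_on slit_plane" "F has_fps_expansion fps_hypergeo [a, b] [of_real (c + 1)] 1"
    using assms(2) by (auto simp: gauss_continuation_def)
  show "(\<lambda>z. F z + 1 / of_real c * (z * deriv F z)) holomorphic_on slit_plane"
    by (intro holomorphic_intros F open_slit_plane)
  show "(\<lambda>z. F z + 1 / of_real c * (z * deriv F z)) has_fps_expansion fps_hypergeo [a, b] [of_real c] 1"
    unfolding fps_hypergeo_lower_denominator[OF assms(1)] by (intro fps_expansion_intros F)
qed

lemma fps_hypergeo_2_1_nth:
  "fps_nth (fps_hypergeo [a, b] [c] 1) n = pochhammer a n * pochhammer b n / (pochhammer c n * fact n)"
  for a b c :: "'a :: field_char_0"
  by simp

lemma fps_hypergeo_2_1_nth_Suc:
  "fps_nth (fps_hypergeo [a, b] [c] 1) (Suc n) =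
     fps_nth (fps_hypergeo [a, b] [c] 1) n * ((a + of_nat n) * (b + of_nat n)) / ((c + of_nat n) * (1 + of_nat n))"
  for a b c :: "'a :: field_char_0"
  unfolding fps_hypergeo_2_1_nth pochhammer_Suc fact_Suc of_nat_mult of_nat_Suc
  by (simp only: times_divide_eq_left times_divide_eq_right divide_divide_eq_left mult_ac of_nat_fact of_nat_mult of_nat_Suc)

lemma fps_hypergeo_lower_numerator:
  assumes "c > 0"
  shows "fps_const (of_real c - b - 1) * fps_hypergeo [a, b] [complex_of_real c] 1 =
    fps_X * (1 - fps_X) * fps_deriv (fps_hypergeo [a, b + 1] [of_real c] 1)
    + (fps_const (of_real c - b - 1) - fps_const a * fps_X) * fps_hypergeo [a, b + 1] [of_real c] 1"
    (is "?l = ?r")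
proof (rule fps_ext)
  fix n
  show "fps_nth ?l n = fps_nth ?r n"
  proof (cases n)
    case 0
    then show ?thesis by simp
  next
    case (Suc m)
    define H where "H = fps_hypergeo [a, b + 1] [complex_of_real c] 1"
    define v where "v = fps_nth H m"
    have nz: "complex_of_real c + of_nat m \<noteq> 0" "(1 + of_nat m :: complex) \<noteq> 0"
      using assms by (auto simp: complex_eq_iff)
    have pc: "pochhammer (complex_of_real c) m \<noteq> 0"
      using assms by (rule pochhammer_of_real_neq_0)
    \<comment> \<open>Every coefficient involved is \<open>w\<close> times a polynomial in
      \<open>a\<close>, \<open>b\<close>, \<open>c\<close>, \<open>m\<close>, so the claim becomes a
      polynomial identity.\<close>
    define w where "w = v / ((of_real c + of_nat m) * (1 + of_nat m))"
    have v: "v = w * ((of_real c + of_nat m) * (1 + of_nat m))"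
      using nz by (simp add: w_def)
    have 1: "fps_nth H n = w * ((a + of_nat m) * (b + 1 + of_nat m))"
      unfolding Suc w_def v_def H_def fps_hypergeo_2_1_nth_Suc by (simp only: times_divide_eq_left times_divide_eq_right)
    have 2: "fps_nth (fps_hypergeo [a, b] [complex_of_real c] 1) n = w * ((a + of_nat m) * b)"
      unfolding Suc w_def v_def H_def fps_hypergeo_2_1_nth pochhammer_Suc[of a] pochhammer_Suc[of "of_real c"]
        pochhammer_rec[of b] fact_Suc of_nat_Suc
      by (simp only: times_divide_eq_left times_divide_eq_right divide_divide_eq_left mult_ac)
    have "fps_X * (1 - fps_X) * fps_deriv H = fps_X * fps_deriv H - fps_X * (fps_X * fps_deriv H)"
      by (simp add: algebra_simps)
    then have "fps_nth ?r n = of_nat n * fps_nth H n - of_nat m * v + (of_real c - b - 1) * fps_nth H n - a * v"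
      unfolding H_def[symmetric] by (cases m) (simp_all add: Suc v_def algebra_simps)
    also have "\<dots> = (of_real c - b - 1) * (w * ((a + of_nat m) * b))"
      unfolding 1 v unfolding Suc of_nat_Suc by algebra
    finally show ?thesis using 2 by simp
  qed
qed

lemma gauss_continuation_lower_numerator:
  assumes "c > 0" "of_real c - b - 1 \<noteq> 0" "gauss_continuation a (b + 1) c F"
  shows "\<exists>G. gauss_continuation a b c G"
proof (intro exI, unfold gauss_continuation_def, intro conjI)
  let ?d = "of_real c - b - 1"
  let ?G = "\<lambda>z. inverse ?d * (z * (1 - z) * deriv F z + (?d - a * z) * F z)"
  have F: "F holomorphic_on slit_plane" "F has_fps_expansion fps_hypergeo [a, b + 1] [of_real c] 1"
    using assms(3) by (auto simp: gauss_continuation_def)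
  show "?G holomorphic_on slit_plane"
    by (intro holomorphic_intros F open_slit_plane)
  have "?G has_fps_expansion fps_const (inverse ?d) * (fps_const ?d * fps_hypergeo [a, b] [of_real c] 1)"
    unfolding fps_hypergeo_lower_numerator[OF assms(1)] by (intro fps_expansion_intros F)
  also have "fps_const (inverse ?d) * (fps_const ?d * fps_hypergeo [a, b] [of_real c] 1) = fps_hypergeo [a, b] [of_real c] 1"
    using assms(2) by (simp only: mult.assoc[symmetric] fps_const_mult) simp
  finally show "?G has_fps_expansion fps_hypergeo [a, b] [of_real c] 1" .
qed

text \<open>Two descents, each by induction on the distance \<open>k\<close> to the good range. For
  \<open>Re b > 1\<close>, Euler's integral applies once \<open>c\<close> is large, and
  \<open>c\<close> is then lowered. A general \<open>b\<close> is reached from \<open>b + k\<close>;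
  here all positive \<open>c\<close> are carried along, since the exceptional case changes
  \<open>c\<close>.\<close>

lemma gauss_continuation_exists:
  assumes "c > 0"
  shows "\<exists>F. gauss_continuation a b c F"
proof -
  have base: "\<exists>F. gauss_continuation a b c F" if "Re b > 1" "c > 0" for b c
  proof -
    obtain k :: nat where "real k > 1 + Re b - c" using reals_Archimedean2 by blast
    then show ?thesis using \<open>c > 0\<close>
    proof (induction k arbitrary: c)
      case 0
      then show ?case using \<open>Re b > 1\<close> by (intro gauss_continuation_euler) auto
    next
      case (Suc k)
      have "\<exists>F. gauss_continuation a b (c + 1) F"
        using Suc.prems by (intro Suc.IH) auto
      then show ?case using gauss_continuation_lower_denominator Suc.prems by blast
    qed
  qed
  obtain k :: nat where "real k > 1 - Re b" using reals_Archimedean2 by blast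
  then show ?thesis using assms
  proof (induction k arbitrary: b c)
    case 0
    then show ?case by (intro base) auto
  next
    case (Suc k)
    have ex: "\<exists>F. gauss_continuation a (b + 1) d F" if "d > 0" for d
      using Suc.prems that by (intro Suc.IH) auto
    show ?case
    proof (cases "of_real c - b - 1 = 0")
      case False
      then show ?thesis using ex[of c] Suc.prems gauss_continuation_lower_numerator by blast
    next
      \<comment> \<open>The operator that lowers \<open>b\<close> degenerates when
        \<open>c - b - 1 = 0\<close>. The detour lowers \<open>b\<close> at \<open>c + 1\<close>,
        where this number is 1, and then lowers the denominator parameter.\<close>
      case True
      then have "of_real (c + 1) - b - 1 \<noteq> 0" by simp
      then obtain G where "gauss_continuation a b (c + 1) G"
        using ex[of "c + 1"] Suc.prems gauss_continuation_lower_numerator[of "c + 1" b a] by auto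
      then show ?thesis using Suc.prems gauss_continuation_lower_denominator by blast
    qed
  qed
qed

text \<open>This matches the germ at 0 with the condition on the unit disc in the definition of
  \<open>gauss_2F1\<close>; the passage from germ to disc rests on the radius of convergence being
  at least 1.\<close>

lemma gauss_continuation_iff:
  assumes "c > 0"
  shows "gauss_continuation a b c F \<longleftrightarrow> F holomorphic_on slit_plane \<and>
     (\<forall>z\<in>ball 0 1. F z = eval_fps (fps_hypergeo [a, b] [of_real c] 1) z)"
proof -
  let ?H = "fps_hypergeo [a, b] [complex_of_real c] 1"
  have rad: "fps_conv_radius ?H \<ge> 1" by (rule conv_radius_hypergeo[OF assms])
  have "F z = eval_fps ?H z" if "F holomorphic_on slit_plane" "F has_fps_expansion ?H" "z \<in> ball 0 1" for z
    using has_fps_expansion_imp_eval_fps_eq[OF that(2), of z 1] that(3)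
      holomorphic_on_subset[OF that(1) ball_subset_slit_plane] by simp
  moreover have "F has_fps_expansion ?H" if "\<forall>z\<in>ball 0 1. F z = eval_fps ?H z"
    unfolding has_fps_expansion_def
  proof
    show "fps_conv_radius ?H > 0" using rad by (rule less_le_trans[rotated]) simp
    show "\<forall>\<^sub>F z in nhds 0. eval_fps ?H z = F z"
      using eventually_nhds_in_open[of "ball 0 (1::real)" "0::complex"] that by (auto elim!: eventually_mono)
  qed
  ultimately show ?thesis unfolding gauss_continuation_def by blast
qed

lemma gauss_continuation_gauss_2F1:
  assumes "c > 0"
  shows "gauss_continuation a b c (gauss_2F1 a b (of_real c))"
  using gauss_continuation_exists[OF assms, of a b]
  unfolding gauss_2F1_def gauss_continuation_iff[OF assms] by (rule someI_ex)

lemma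
  assumes "c > 0"
  shows holomorphic_gauss_2F1: "gauss_2F1 a b (of_real c) holomorphic_on slit_plane"
    and has_fps_expansion_gauss_2F1: "gauss_2F1 a b (of_real c) has_fps_expansion fps_hypergeo [a, b] [of_real c] 1"
  using gauss_continuation_gauss_2F1[OF assms] by (auto simp: gauss_continuation_def)

subsection \<open>Pfaff transformation and contiguous relations\<close>

text \<open>The formal power \<open>(1 - X)^(-a)\<close>; for \<open>a = 1\<close> it is the
  geometric series.\<close>

definition fps_geometric_power :: "complex \<Rightarrow> complex fps" where
  "fps_geometric_power a = fps_binomial (- a) oo (- fps_X)"

lemma fps_geometric_power_add: "fps_geometric_power (a + b) = fps_geometric_power a * fps_geometric_power b"
  unfolding fps_geometric_power_def minus_add_distrib fps_binomial_add_mult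
  by (rule fps_compose_mult_distrib) simp

lemma fps_geometric_power_nth: "fps_nth (fps_geometric_power a) n = pochhammer a n / fact n"
proof -
  have "fps_nth (fps_geometric_power a) n = (- 1) ^ n * ((- a) gchoose n)"
    by (simp add: fps_geometric_power_def fps_compose_uminus')
  then show ?thesis by (cases "even n") (auto simp: gbinomial_pochhammer)
qed

lemma fps_geometric_power_power: "fps_geometric_power a ^ n = fps_geometric_power (of_nat n * a)"
proof (induction n)
  case 0
  show ?case by (rule fps_ext) (auto simp: fps_geometric_power_nth pochhammer_0_left)
qed (simp add: fps_geometric_power_add algebra_simps)

lemma has_fps_expansion_geometric_power: "(\<lambda>z. (1 - z) powr (- a)) has_fps_expansion fps_geometric_power a"
proof -
  have "((\<lambda>x. (1 + x) powr (- a)) \<circ> uminus) has_fps_expansion fps_geometric_power a"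
    unfolding fps_geometric_power_def by (intro fps_expansion_intros) auto
  then show ?thesis by (simp add: o_def)
qed

lemma pochhammer_minus_of_nat:
  assumes "k \<le> n"
  shows "pochhammer (- of_nat n :: 'a :: field_char_0) k = (- 1) ^ k * fact n / fact (n - k)"
proof -
  have "pochhammer (- of_nat n :: 'a) k = (- 1) ^ k * fact k * of_nat (n choose k)"
    unfolding binomial_gbinomial gbinomial_pochhammer by (simp add: power_mult_distrib[symmetric])
  also have "\<dots> = (- 1) ^ k * fact n / fact (n - k)"
    using assms by (simp add: binomial_fact)
  finally show ?thesis .
qed

text \<open>The \<open>k\<close>-th power of \<open>- X / (1 - X)\<close> times
  \<open>(1 - X)^(-a)\<close> is \<open>(-1)^k X^k (1 - X)^(-a-k)\<close>. Its coefficient at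
  \<open>X^n\<close> turns the sum over \<open>k\<close> into a terminating sum at argument 1,
  evaluated by the Chu-Vandermonde identity.\<close>

lemma fps_hypergeo_pfaff:
  assumes "c > 0"
  shows "fps_geometric_power a * (fps_hypergeo [a, of_real c - b] [of_real c] 1 oo (- fps_X * fps_geometric_power 1))
       = fps_hypergeo [a, b] [complex_of_real c] 1"
proof (rule fps_ext)
  fix n
  let ?H = "fps_hypergeo [a, of_real c - b] [complex_of_real c] 1"
  define G where "G = - fps_X * fps_geometric_power 1"
  have G0: "fps_nth G 0 = 0" by (simp add: G_def)
  \<comment> \<open>Since \<open>G\<close> has no constant term, the terms with \<open>k > i\<close>
    vanish. A limit \<open>n\<close> common to all \<open>i\<close> lets the two sums be
    exchanged.\<close>
  have comp: "fps_nth (?H oo G) i = (\<Sum>k=0..n. fps_nth ?H k * fps_nth (G ^ k) i)" if "i \<le> n" for i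
    unfolding fps_compose_nth
    by (rule sum.mono_neutral_left) (use that startsby_zero_power_prefix[OF G0] in auto)
  have G: "fps_nth (G ^ k * fps_geometric_power a) n = (- 1) ^ k * pochhammer (a + of_nat k) (n - k) / fact (n - k)"
    if "k \<le> n" for k
  proof -
    have "G ^ k = fps_const ((- 1) ^ k) * fps_X ^ k * fps_geometric_power (of_nat k)"
      unfolding G_def power_mult_distrib fps_geometric_power_power power_minus[of fps_X] 
      by (simp add: fps_const_power[symmetric] fps_const_neg[symmetric] del: fps_const_power fps_const_neg)
    then have "G ^ k * fps_geometric_power a = fps_const ((- 1) ^ k) * (fps_X ^ k * fps_geometric_power (a + of_nat k))"
      by (simp add: fps_geometric_power_add mult_ac)
    then show ?thesis
      using that by (simp add: fps_X_power_mult_nth fps_geometric_power_nth)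
  qed
  have "fps_nth (fps_geometric_power a * (?H oo G)) n
      = (\<Sum>i=0..n. (\<Sum>k=0..n. fps_nth ?H k * fps_nth (G ^ k) i) * fps_nth (fps_geometric_power a) (n - i))"
    unfolding mult.commute[of "fps_geometric_power a"] fps_mult_nth by (intro sum.cong refl) (simp add: comp)
  also have "\<dots> = (\<Sum>i=0..n. \<Sum>k=0..n. fps_nth ?H k * (fps_nth (G ^ k) i * fps_nth (fps_geometric_power a) (n - i)))"
    unfolding sum_distrib_right mult.assoc ..
  also have "\<dots> = (\<Sum>k=0..n. \<Sum>i=0..n. fps_nth ?H k * (fps_nth (G ^ k) i * fps_nth (fps_geometric_power a) (n - i)))"
    by (rule sum.swap)
  also have "\<dots> = (\<Sum>k=0..n. fps_nth ?H k * fps_nth (G ^ k * fps_geometric_power a) n)"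
    unfolding fps_mult_nth sum_distrib_left ..
  also have "\<dots> = (\<Sum>k=0..n. pochhammer a n / fact n * ((pochhammer (of_real c - b) k * pochhammer (- of_nat n) k) /
      (of_nat (fact k) * pochhammer (of_real c) k)))"
  proof (intro sum.cong refl)
    fix k assume "k \<in> {0..n}"
    then have k: "k \<le> n" by simp
    have "pochhammer a n = pochhammer a k * pochhammer (a + of_nat k) (n - k)"
      using k by (rule pochhammer_product)
    then show "fps_nth ?H k * fps_nth (G ^ k * fps_geometric_power a) n =
       pochhammer a n / fact n * ((pochhammer (of_real c - b) k * pochhammer (- of_nat n) k) /
      (of_nat (fact k) * pochhammer (of_real c) k))"
      unfolding G[OF k] pochhammer_minus_of_nat[OF k] fps_hypergeo_2_1_nth by (simp add: mult_ac)
  qed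
  also have "\<dots> = pochhammer a n / fact n * (pochhammer (of_real c - (of_real c - b)) n / pochhammer (of_real c) n)"
    unfolding sum_distrib_left[symmetric]
    by (subst Vandermonde_pochhammer) (use assms in \<open>auto simp: complex_eq_iff\<close>)
  finally show "fps_nth (fps_geometric_power a * (?H oo (- fps_X * fps_geometric_power 1))) n
      = fps_nth (fps_hypergeo [a, b] [complex_of_real c] 1) n"
    by (simp add: G_def)
qed

text \<open>The half-plane consists of the points closer to 0 than to 1.\<close>

lemma norm_div_diff_one_less:
  assumes "Re z < 1 / 2"
  shows "norm (z / (z - 1)) < 1"
proof -
  have "(norm z)\<^sup>2 < (norm (z - 1))\<^sup>2"
    using assms unfolding cmod_power2 by (simp add: power2_eq_square algebra_simps)
  then have "norm z < norm (z - 1)" by (rule power2_less_imp_less) simp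
  then show ?thesis by (simp add: norm_divide divide_simps)
qed

text \<open>The half-plane is connected, lies in the slit plane and contains every
  \<open>- x\<close> with \<open>x \<ge> 0\<close>, so the formal identity at 0 propagates to all
  arguments of the kernel.\<close>

lemma gauss_2F1_pfaff:
  assumes "c > 0" "Re z < 1 / 2"
  shows "gauss_2F1 a b (of_real c) z =
    (1 - z) powr (- a) * eval_fps (fps_hypergeo [a, of_real c - b] [of_real c] 1) (z / (z - 1))"
proof -
  let ?H = "fps_hypergeo [a, of_real c - b] [complex_of_real c] 1"
  let ?f = "\<lambda>z. gauss_2F1 a b (of_real c) z - (1 - z) powr (- a) * (eval_fps ?H \<circ> (\<lambda>z. z / (z - 1))) z"
  let ?U = "{z. Re z < 1 / 2}"
  have rad: "fps_conv_radius ?H \<ge> 1" by (rule conv_radius_hypergeo[OF assms(1)])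
  then have rad0: "fps_conv_radius ?H > 0" by (rule less_le_trans[rotated]) simp
  have g: "(\<lambda>z::complex. z / (z - 1)) has_fps_expansion - fps_X * fps_geometric_power 1"
  proof -
    have "(\<lambda>z::complex. - z * (1 - z) powr (- 1)) has_fps_expansion - fps_X * fps_geometric_power 1"
      by (intro fps_expansion_intros has_fps_expansion_geometric_power)
    also have "(\<lambda>z::complex. - z * (1 - z) powr (- 1)) = (\<lambda>z. z / (z - 1))"
    proof
      fix z :: complex
      show "- z * (1 - z) powr (- 1) = z / (z - 1)"
      proof (cases "z = 1")
        case False
        then have "1 - z \<noteq> 0" "z - 1 \<noteq> 0" by auto
        then show ?thesis by (simp add: powr_minus field_simps)
      qed simp
    qed
    finally show ?thesis .
  qed
  have "?f has_fps_expansion fps_hypergeo [a, b] [of_real c] 1 - fps_geometric_power a * (?H oo (- fps_X * fps_geometric_power 1))"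
    by (intro fps_expansion_intros has_fps_expansion_gauss_2F1 has_fps_expansion_geometric_power
          eval_fps_has_fps_expansion g assms rad0) simp
  then have exp: "?f has_fps_expansion 0"
    unfolding fps_hypergeo_pfaff[OF assms(1)] diff_self .
  have hol: "?f holomorphic_on ?U"
  proof -
    have "?U \<subseteq> slit_plane" by (auto simp: slit_plane_iff)
    then have 1: "gauss_2F1 a b (of_real c) holomorphic_on ?U"
      using holomorphic_gauss_2F1[OF assms(1)] holomorphic_on_subset by blast
    have 2: "eval_fps ?H \<circ> (\<lambda>z. z / (z - 1)) holomorphic_on ?U"
    proof (rule holomorphic_on_compose_gen)
      show "(\<lambda>z. z / (z - 1)) holomorphic_on ?U" by (auto intro!: holomorphic_intros)
      show "eval_fps ?H holomorphic_on ball 0 1"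
        by (rule holomorphic_on_eval_fps) (use ball_eball_mono[of 1] rad in \<open>auto simp: one_ereal_def\<close>)
      show "(\<lambda>z. z / (z - 1)) ` ?U \<subseteq> ball 0 1" using norm_div_diff_one_less by auto
    qed
    have 3: "(\<lambda>z. (1 - z) powr (- a)) holomorphic_on ?U"
      by (auto intro!: holomorphic_intros simp: complex_nonpos_Reals_iff)
    show ?thesis by (intro holomorphic_intros 1 2 3)
  qed
  have "?f z = 0"
  proof (rule has_fps_expansion_0_analytic_continuation[OF exp hol])
    show "open ?U" by (rule open_halfspace_Re_lt)
    show "connected ?U" by (intro convex_connected convex_halfspace_Re_lt)
  qed (use assms(2) in auto)
  then show ?thesis by simp
qed

lemma deriv_gauss_2F1:
  assumes "c > 0" "z \<in> slit_plane"
  shows "deriv (gauss_2F1 a b (of_real c)) z = a * b / of_real c * gauss_2F1 (a + 1) (b + 1) (of_real (c + 1)) z"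
proof -
  have eq: "fps_deriv (fps_hypergeo [a, b] [complex_of_real c] 1) =
     fps_const (a * b / of_real c) * fps_hypergeo [a + 1, b + 1] [of_real (c + 1)] 1"
  proof (rule fps_ext)
    fix n
    show "fps_nth (fps_deriv (fps_hypergeo [a, b] [complex_of_real c] 1)) n =
      fps_nth (fps_const (a * b / of_real c) * fps_hypergeo [a + 1, b + 1] [of_real (c + 1)] 1) n"
      unfolding fps_deriv_nth fps_mult_left_const_nth fps_hypergeo_2_1_nth Suc_eq_plus1[symmetric] pochhammer_rec fact_Suc
      using of_nat_neq_0[of n, where 'a = complex] by (simp del: of_nat_Suc add: mult_ac)
  qed
  let ?f = "\<lambda>z. deriv (gauss_2F1 a b (of_real c)) z - a * b / of_real c * gauss_2F1 (a + 1) (b + 1) (of_real (c + 1)) z"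
  have exp: "?f has_fps_expansion 0"
  proof -
    have "?f has_fps_expansion fps_deriv (fps_hypergeo [a, b] [of_real c] 1)
       - fps_const (a * b / of_real c) * fps_hypergeo [a + 1, b + 1] [of_real (c + 1)] 1"
      using assms by (intro fps_expansion_intros has_fps_expansion_gauss_2F1) auto
    then show ?thesis by (simp add: eq)
  qed
  have hol: "?f holomorphic_on slit_plane"
    using assms by (intro holomorphic_intros holomorphic_deriv holomorphic_gauss_2F1 open_slit_plane) auto
  show ?thesis
    using has_fps_expansion_0_analytic_continuation[OF exp hol open_slit_plane connected_slit_plane zero_in_slit_plane assms(2)]
    by simp
qed

text \<open>For \<open>p = b + i s\<close> and \<open>q = b - i s\<close>, replacing
  \<open>s\<close> by \<open>s + i\<close> means \<open>(p - 1, q + 1)\<close>, and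
  \<open>s - i\<close> means \<open>(p + 1, q - 1)\<close>. With \<open>b + c\<close> in place of
  \<open>c\<close>, the numbers \<open>A\<close> and \<open>B\<close> are the coefficients of the
  difference operator.\<close>

lemma gauss_2F1_contiguous:
  fixes p q :: complex and c :: real
  assumes c: "c > 0" and z: "z \<in> slit_plane" and nz: "p \<noteq> 0" "q \<noteq> 0" "p - q \<noteq> 0" "1 - p + q \<noteq> 0" "1 - q + p \<noteq> 0"
  defines "A \<equiv> q * (q + 1) * (of_real c - p) / ((p - q) * (1 - p + q))"
    and "B \<equiv> p * (p + 1) * (of_real c - q) / ((q - p) * (1 - q + p))"
    and "F \<equiv> (\<lambda>p q. gauss_2F1 p q (of_real c))"
  shows "z * (1 - z) * deriv (F p q) z - (p + q + 1) * z * F p q z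
    + A * (F (p - 1) (q + 1) z - F p q z) + B * (F (p + 1) (q - 1) z - F p q z) = 0"
proof -
  define H where "H p q = fps_hypergeo [p, q] [complex_of_real c] 1" for p q
  have H_sym: "H p q = H q p" for p q by (simp add: H_def fps_eq_iff mult.commute)
  \<comment> \<open>Expressed through the coefficient of \<open>H p q\<close> one degree lower, the
    shifted coefficients become comparable. The other shift is this one with \<open>p\<close> and
    \<open>q\<close> exchanged.\<close>
  have shift: "fps_nth (H (p - 1) (q + 1)) (Suc m) =
      fps_nth (H p q) m / ((of_real c + of_nat m) * (1 + of_nat m)) * ((p - 1) / q * ((q + of_nat m) * (q + 1 + of_nat m)))"
    if "q \<noteq> 0" for p q m
  proof -
    have "pochhammer q m * (q + of_nat m) = q * pochhammer (q + 1) m"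
      by (metis pochhammer_Suc pochhammer_rec)
    then have *: "pochhammer (q + 1) m = pochhammer q m * (q + of_nat m) / q"
      using that by (simp add: field_simps)
    show ?thesis
      unfolding H_def fps_hypergeo_2_1_nth pochhammer_Suc[of "q + 1"] pochhammer_Suc[of "of_real c"]
        pochhammer_rec[of "p - 1"] * fact_Suc of_nat_Suc diff_add_cancel
      by (simp only: times_divide_eq_left times_divide_eq_right divide_divide_eq_left mult_ac)
  qed
  have eq: "fps_X * (1 - fps_X) * fps_deriv (H p q) - fps_const (p + q + 1) * fps_X * H p q
    + fps_const A * (H (p - 1) (q + 1) - H p q) + fps_const B * (H (p + 1) (q - 1) - H p q) = 0" (is "?l = 0")
  proof (rule fps_ext)
    fix n
    show "fps_nth ?l n = fps_nth 0 n"
    proof (cases n)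
      case 0
      then show ?thesis by (simp add: H_def)
    next
      case (Suc m)
      have cm: "complex_of_real c + of_nat m \<noteq> 0" "(1 + of_nat m :: complex) \<noteq> 0"
        using c by (auto simp: complex_eq_iff)
      define v where "v = fps_nth (H p q) m"
      define w where "w = v / ((of_real c + of_nat m) * (1 + of_nat m))"
      have v: "v = w * ((of_real c + of_nat m) * (1 + of_nat m))"
        using cm by (simp add: w_def)
      have 1: "fps_nth (H p q) (Suc m) = w * ((p + of_nat m) * (q + of_nat m))"
        unfolding w_def v_def H_def fps_hypergeo_2_1_nth_Suc by (simp only: times_divide_eq_left times_divide_eq_right)
      have 2: "fps_nth (H (p - 1) (q + 1)) (Suc m) = w * ((p - 1) / q * ((q + of_nat m) * (q + 1 + of_nat m)))"
        unfolding shift[OF nz(2)] w_def v_def ..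
      have 3: "fps_nth (H (p + 1) (q - 1)) (Suc m) = w * ((q - 1) / p * ((p + of_nat m) * (p + 1 + of_nat m)))"
        unfolding H_sym[of "p + 1"] shift[OF nz(1)] w_def v_def H_sym[of q p] ..
      have cancel: "x * u * d / (e * r) * (w * (- y * r * k / x)) * e = - w * u * d * y * k"
        if "x \<noteq> 0" "e \<noteq> 0" "r \<noteq> 0" for x u d e r y k :: complex
        using that by simp
      \<comment> \<open>The difference of coefficients contains the factor \<open>1 - p + q\<close>,
        which cancels against the denominator of \<open>A\<close>, as \<open>q\<close> cancels
        against its numerator. Multiplying by \<open>p - q\<close> clears what is left.\<close>
      have A: "A * (fps_nth (H (p - 1) (q + 1)) (Suc m) - fps_nth (H p q) (Suc m)) * (p - q)
          = - w * (q + 1) * (of_real c - p) * (q + of_nat m) * (1 + of_nat m)"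
      proof -
        have "(p - 1) / q * ((q + of_nat m) * (q + 1 + of_nat m)) - (p + of_nat m) * (q + of_nat m)
            = - (q + of_nat m) * (1 - p + q) * (1 + of_nat m) / q"
          using nz(2) by (simp add: divide_simps) (simp add: algebra_simps)
        then have D: "fps_nth (H (p - 1) (q + 1)) (Suc m) - fps_nth (H p q) (Suc m)
            = w * (- (q + of_nat m) * (1 - p + q) * (1 + of_nat m) / q)"
          unfolding 1 2 right_diff_distrib[symmetric] by simp
        show ?thesis unfolding A_def D by (rule cancel[OF nz(2,3,4)])
      qed
      have B: "B * (fps_nth (H (p + 1) (q - 1)) (Suc m) - fps_nth (H p q) (Suc m)) * (p - q)
          = w * (p + 1) * (of_real c - q) * (p + of_nat m) * (1 + of_nat m)"
      proof -
        have "(q - 1) / p * ((p + of_nat m) * (p + 1 + of_nat m)) - (p + of_nat m) * (q + of_nat m)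
            = - (p + of_nat m) * (1 - q + p) * (1 + of_nat m) / p"
          using nz(1) by (simp add: divide_simps) (simp add: algebra_simps)
        then have D: "fps_nth (H (p + 1) (q - 1)) (Suc m) - fps_nth (H p q) (Suc m)
            = w * (- (p + of_nat m) * (1 - q + p) * (1 + of_nat m) / p)"
          unfolding 1 3 right_diff_distrib[symmetric] by simp
        have "q - p \<noteq> 0" using nz(3) by simp
        then have "B * (fps_nth (H (p + 1) (q - 1)) (Suc m) - fps_nth (H p q) (Suc m)) * (q - p)
          = - w * (p + 1) * (of_real c - q) * (p + of_nat m) * (1 + of_nat m)"
          unfolding B_def D by (intro cancel nz)
        then show ?thesis by algebra
      qed
      have "fps_X * (1 - fps_X) * fps_deriv (H p q) = fps_X * fps_deriv (H p q) - fps_X * (fps_X * fps_deriv (H p q))"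
        by (simp add: algebra_simps)
      then have "fps_nth ?l n = (1 + of_nat m) * fps_nth (H p q) (Suc m) - of_nat m * v - (p + q + 1) * v
         + A * (fps_nth (H (p - 1) (q + 1)) (Suc m) - fps_nth (H p q) (Suc m))
         + B * (fps_nth (H (p + 1) (q - 1)) (Suc m) - fps_nth (H p q) (Suc m))"
        by (cases m) (simp_all add: Suc v_def mult.assoc)
      then have "fps_nth ?l n * (p - q) = 
        ((1 + of_nat m) * fps_nth (H p q) (Suc m) - of_nat m * v - (p + q + 1) * v) * (p - q)
         + A * (fps_nth (H (p - 1) (q + 1)) (Suc m) - fps_nth (H p q) (Suc m)) * (p - q)
         + B * (fps_nth (H (p + 1) (q - 1)) (Suc m) - fps_nth (H p q) (Suc m)) * (p - q)"
        by (simp only: distrib_right)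
      also have "\<dots> = 0" unfolding A B unfolding 1 v by algebra
      finally show ?thesis using nz(3) by simp
    qed
  qed
  let ?f = "\<lambda>z. z * (1 - z) * deriv (F p q) z - (p + q + 1) * z * F p q z
    + A * (F (p - 1) (q + 1) z - F p q z) + B * (F (p + 1) (q - 1) z - F p q z)"
  have F: "F p q holomorphic_on slit_plane" "F p q has_fps_expansion H p q" for p q
    unfolding F_def H_def by (intro holomorphic_gauss_2F1 has_fps_expansion_gauss_2F1 c)+
  have "?f has_fps_expansion ?l" by (intro fps_expansion_intros F)
  then have exp: "?f has_fps_expansion 0" unfolding eq .
  have hol: "?f holomorphic_on slit_plane"
    by (intro holomorphic_intros holomorphic_deriv F open_slit_plane)
  show ?thesis
    by (rule has_fps_expansion_0_analytic_continuation[OF exp hol open_slit_plane connected_slit_plane zero_in_slit_plane z])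
qed

subsection \<open>The kernel of the transform\<close>

text \<open>In the usual notation, with \<open>x = sinh^2 t\<close>, this is the Jacobi function
  with spectral parameter \<open>2 s\<close>, \<open>alpha = b + c - 1\<close> and
  \<open>beta = b - c\<close>; the weight of the transform is
  \<open>x^alpha (1 + x)^beta\<close>.\<close>

definition jacobi_fun :: "real \<Rightarrow> real \<Rightarrow> complex \<Rightarrow> real \<Rightarrow> complex" where
  "jacobi_fun b c s x = gauss_2F1 (of_real b + \<i> * s) (of_real b - \<i> * s) (of_real (b + c)) (- of_real x)"

lemma jacobi_fun_pfaff:
  assumes "b > 0" "c > 0" "x \<ge> 0"
  shows "jacobi_fun b c s x = of_real (1 + x) powr (- (of_real b + \<i> * s)) *
    eval_fps (fps_hypergeo [of_real b + \<i> * s, of_real c + \<i> * s] [of_real (b + c)] 1) (of_real (x / (1 + x)))"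
proof -
  have 1: "complex_of_real (b + c) - (of_real b - \<i> * s) = of_real c + \<i> * s" by simp
  have "- complex_of_real x - 1 = - of_real (1 + x)" by simp
  then have "- complex_of_real x / (- of_real x - 1) = of_real x / of_real (1 + x)"
    by (simp only: minus_divide_divide)
  then have 2: "- complex_of_real x / (- of_real x - 1) = of_real (x / (1 + x))" by simp
  show ?thesis
    unfolding jacobi_fun_def using assms gauss_2F1_pfaff[of "b + c" "- of_real x"] unfolding 1 2 by simp
qed

text \<open>In the Pfaff series \<open>s\<close> occurs only in upper parameters, so the partial
  sums are polynomials in \<open>s\<close>; by the coefficient bound they converge locally
  uniformly.\<close>

lemma holomorphic_jacobi_fun:
  assumes "b > 0" "c > 0" "x \<ge> 0"
  shows "(\<lambda>s. jacobi_fun b c s x) holomorphic_on UNIV"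
proof -
  let ?H = "\<lambda>s. fps_hypergeo [of_real b + \<i> * s, of_real c + \<i> * s] [complex_of_real (b + c)] 1"
  define w where "w = x / (1 + x)"
  have w: "0 \<le> w" "w < 1" using assms by (auto simp: w_def)
  have "(\<lambda>s. eval_fps (?H s) (of_real w)) holomorphic_on UNIV"
  proof (rule holomorphic_uniform_sequence[where f = "\<lambda>N s. \<Sum>n<N. fps_nth (?H s) n * of_real w ^ n"])
    show "(\<lambda>s. \<Sum>n<N. fps_nth (?H s) n * of_real w ^ n) holomorphic_on UNIV" for N
    proof (intro holomorphic_intros)
      fix n
      have "pochhammer (complex_of_real (b + c)) n \<noteq> 0" using assms by (intro pochhammer_of_real_neq_0) auto
      then show "(\<lambda>s. fps_nth (?H s) n) holomorphic_on UNIV"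
        unfolding fps_hypergeo_2_1_nth pochhammer_prod by (intro holomorphic_intros) (auto simp flip: pochhammer_prod)
    qed
    fix s0 :: complex
    \<comment> \<open>The upper parameters exceed the lower one in real part by
      \<open>- 2 Im s\<close>, which is at most \<open>\<eta>\<close> on the unit ball about
      \<open>s0\<close>.\<close>
    define \<eta> where "\<eta> = 2 * (norm s0 + 1)"
    define R where "R = b + c + norm s0 + 1"
    have \<eta>: "\<eta> > 0" unfolding \<eta>_def by (intro mult_pos_pos add_nonneg_pos) auto
    obtain K where K: "K > 0" "\<And>a b' n. norm a \<le> R \<Longrightarrow> norm b' \<le> R \<Longrightarrow> Re a + Re b' - (b + c) \<le> \<eta> \<Longrightarrow>
      norm (fps_nth (fps_hypergeo [a, b'] [complex_of_real (b + c)] 1) n) \<le> K * (pochhammer \<eta> n / fact n)"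
      using norm_hypergeo_nth_le[of "b + c" \<eta> R] assms \<eta> by auto
    have "uniform_limit (cball s0 1) (\<lambda>N s. \<Sum>n<N. fps_nth (?H s) n * of_real w ^ n)
       (\<lambda>s. \<Sum>n. fps_nth (?H s) n * of_real w ^ n) sequentially"
    proof (rule Weierstrass_m_test)
      show "summable (\<lambda>n. K * (pochhammer \<eta> n / fact n * w ^ n))"
        using w by (intro summable_mult sums_summable[OF sums_neg_binomial]) auto
      fix n s assume s: "s \<in> cball s0 1"
      have ns: "norm s \<le> norm s0 + 1"
        using s norm_triangle_ineq2[of s s0] by (simp add: dist_norm norm_minus_commute)
      have nR: "norm (of_real d + \<i> * s) \<le> R" if "0 < d" "d \<le> b + c" for d
        using norm_triangle_ineq[of "of_real d" "\<i> * s"] ns that by (simp add: norm_mult R_def)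
      have "- Im s \<le> norm s0 + 1" using abs_Im_le_cmod[of s] ns by linarith
      then have "norm (fps_nth (?H s) n) \<le> K * (pochhammer \<eta> n / fact n)"
        using assms by (intro K nR) (auto simp: \<eta>_def)
      from mult_right_mono[OF this, of "w ^ n"] w
      show "norm (fps_nth (?H s) n * of_real w ^ n) \<le> K * (pochhammer \<eta> n / fact n * w ^ n)"
        by (simp only: norm_mult norm_power norm_of_real abs_of_nonneg zero_le_power mult.assoc)
    qed
    then show "\<exists>d>0. cball s0 d \<subseteq> UNIV \<and> uniform_limit (cball s0 d)
       (\<lambda>N s. \<Sum>n<N. fps_nth (?H s) n * of_real w ^ n) (\<lambda>s. eval_fps (?H s) (of_real w)) sequentially"
      unfolding eval_fps_def by (intro exI[of _ 1]) auto
  qed auto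
  moreover have "1 + complex_of_real x \<noteq> 0" using assms by (auto simp: complex_eq_iff)
  ultimately show ?thesis
    unfolding jacobi_fun_pfaff[OF assms] w_def[symmetric] using assms
    by (auto intro!: holomorphic_intros)
qed

text \<open>In the Pfaff form the prefactor has modulus \<open>(1 + x) powr (Im s - b)\<close>. As
  \<open>1 - x / (1 + x) = 1 / (1 + x)\<close>, the series is at most a constant times
  \<open>(1 + x) powr \<eta>\<close>. With \<open>\<eta>\<close> close to
  \<open>max 0 (- 2 Im s)\<close> the exponents add up to about
  \<open>\<bar>Im s\<bar> - b\<close>.\<close>

lemma jacobi_fun_bound:
  assumes "b > 0" "c > 0" "\<sigma> > \<bar>Im s0\<bar>"
  obtains r K where "r > 0" "K > 0"
    "\<And>s x. s \<in> cball s0 r \<Longrightarrow> x \<ge> 0 \<Longrightarrow> norm (jacobi_fun b c s x) \<le> K * (1 + x) powr (\<sigma> - b)"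
proof -
  define \<delta> where "\<delta> = (\<sigma> - \<bar>Im s0\<bar>) / 2"
  \<comment> \<open>The summand \<open>\<delta>\<close> makes \<open>\<eta>\<close> positive and
    absorbs the variation of \<open>- 2 Im s\<close> over a ball of radius
    \<open>\<delta> / 2\<close>; the total loss \<open>3 \<delta> / 2\<close> stays below the gap
    \<open>2 \<delta>\<close>.\<close>
  define \<eta> where "\<eta> = max 0 (- 2 * Im s0) + \<delta>"
  define R where "R = b + c + norm s0 + \<delta>"
  have \<delta>: "\<delta> > 0" using assms by (simp add: \<delta>_def)
  have \<eta>: "\<eta> > 0" using \<delta> by (simp add: \<eta>_def)
  obtain K where K: "K > 0" "\<And>a b' n. norm a \<le> R \<Longrightarrow> norm b' \<le> R \<Longrightarrow> Re a + Re b' - (b + c) \<le> \<eta> \<Longrightarrow>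
    norm (fps_nth (fps_hypergeo [a, b'] [complex_of_real (b + c)] 1) n) \<le> K * (pochhammer \<eta> n / fact n)"
    using norm_hypergeo_nth_le[of "b + c" \<eta> R] assms \<eta> by auto
  show ?thesis
  proof (rule that[of "\<delta> / 2" K])
    fix s x assume s: "s \<in> cball s0 (\<delta> / 2)" and x: "(x::real) \<ge> 0"
    have ns: "norm s \<le> norm s0 + \<delta>"
      using s norm_triangle_ineq2[of s s0] \<delta> by (simp add: dist_norm norm_minus_commute)
    have ims: "\<bar>Im s - Im s0\<bar> \<le> \<delta> / 2"
      using s abs_Im_le_cmod[of "s - s0"] by (simp add: dist_norm norm_minus_commute)
    have im2: "- (2 * Im s) \<le> \<eta>"
      using ims unfolding \<eta>_def max_def by (auto simp: abs_if split: if_splits)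
    have nR: "norm (of_real d + \<i> * s) \<le> R" if "0 < d" "d \<le> b + c" for d
      using norm_triangle_ineq[of "of_real d" "\<i> * s"] ns that by (simp add: norm_mult R_def)
    have w: "1 - x / (1 + x) = 1 / (1 + x)" using x by (simp add: field_simps)
    have "norm (eval_fps (fps_hypergeo [of_real b + \<i> * s, of_real c + \<i> * s] [of_real (b + c)] 1) (of_real (x / (1 + x))))
      \<le> K * (1 - norm (complex_of_real (x / (1 + x)))) powr (- \<eta>)"
    proof (rule norm_eval_hypergeo_le)
      show "norm (fps_nth (fps_hypergeo [of_real b + \<i> * s, of_real c + \<i> * s] [of_real (b + c)] 1) n) \<le> K * (pochhammer \<eta> n / fact n)" for n
        using assms im2 by (intro K nR) auto
      show "norm (complex_of_real (x / (1 + x))) < 1" using x unfolding norm_of_real by simp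
    qed (use assms in auto)
    also have "(1 - norm (complex_of_real (x / (1 + x)))) powr (- \<eta>) = (1 + x) powr \<eta>"
      using x w by (simp only: norm_of_real) (simp add: powr_minus powr_divide divide_simps)
    finally have "norm (jacobi_fun b c s x) \<le> (1 + x) powr (Im s - b) * (K * (1 + x) powr \<eta>)"
      unfolding jacobi_fun_pfaff[OF assms(1,2) x] norm_mult
      using x by (intro mult_mono) (auto simp: norm_powr_real_powr)
    also have "\<dots> = K * (1 + x) powr (Im s - b + \<eta>)" by (simp add: powr_add mult_ac)
    also have "\<dots> \<le> K * (1 + x) powr (\<sigma> - b)"
    proof -
      have "Im s \<le> Im s0 + \<delta> / 2" using ims by linarith
      moreover have "max 0 (- 2 * Im s0) + Im s0 = \<bar>Im s0\<bar>" by (auto simp: max_def abs_if)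
      moreover have "\<sigma> = \<bar>Im s0\<bar> + 2 * \<delta>" by (simp add: \<delta>_def field_simps)
      ultimately have "Im s + \<eta> \<le> \<sigma>" using \<delta> unfolding \<eta>_def by linarith
      then show ?thesis using x K(1) by (intro mult_left_mono powr_mono) auto
    qed
    finally show "norm (jacobi_fun b c s x) \<le> K * (1 + x) powr (\<sigma> - b)" .
  qed (use \<delta> K in auto)
qed

text \<open>Raising all three parameters of the Gauss function by one is raising \<open>b\<close> by
  one, so the derivative is again a kernel and obeys the same growth bound.\<close>

lemma has_vector_derivative_jacobi_fun:
  assumes "b > 0" "c > 0" "x \<ge> 0"
  shows "(jacobi_fun b c s has_vector_derivative
     - ((of_real b + \<i> * s) * (of_real b - \<i> * s) / of_real (b + c) * jacobi_fun (b + 1) c s x)) (at x)"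
proof -
  let ?F = "gauss_2F1 (of_real b + \<i> * s) (of_real b - \<i> * s) (of_real (b + c))"
  have z: "- complex_of_real x \<in> slit_plane" using assms by simp
  have pos: "b + c > 0" using assms by simp
  have "(?F has_field_derivative deriv ?F (- of_real x)) (at (- of_real x))"
    by (rule holomorphic_derivI[OF holomorphic_gauss_2F1[OF pos] open_slit_plane z])
  also have "deriv ?F (- of_real x) = (of_real b + \<i> * s) * (of_real b - \<i> * s) / of_real (b + c) * jacobi_fun (b + 1) c s x"
    unfolding deriv_gauss_2F1[OF pos z] jacobi_fun_def by (simp add: algebra_simps)
  finally have "(?F \<circ> uminus has_field_derivative
     (of_real b + \<i> * s) * (of_real b - \<i> * s) / of_real (b + c) * jacobi_fun (b + 1) c s x * (- 1)) (at (of_real x))"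
    by (intro DERIV_chain) (auto intro!: derivative_eq_intros)
  from has_vector_derivative_real_field[OF this] show ?thesis
    by (simp add: o_def jacobi_fun_def[abs_def])
qed

lemma continuous_on_jacobi_fun:
  assumes "b > 0" "c > 0"
  shows "continuous_on {0..} (jacobi_fun b c s)"
  using has_vector_derivative_jacobi_fun[OF assms] has_vector_derivative_continuous
  by (intro continuous_at_imp_continuous_on) blast

lemma jacobi_fun_contiguous:
  fixes s :: real
  assumes "b > 0" "c > 0" "x \<ge> 0" "s \<noteq> 0"
  defines "p \<equiv> of_real b + \<i> * of_real s" and "q \<equiv> of_real b - \<i> * of_real s"
  shows "(q * (q + 1) * (of_real c - \<i> * of_real s) / ((2 * \<i> * of_real s) * (1 - 2 * \<i> * of_real s))) *
       (jacobi_fun b c (of_real s + \<i>) x - jacobi_fun b c (of_real s) x)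
     + (p * (p + 1) * (of_real c + \<i> * of_real s) / ((- 2 * \<i> * of_real s) * (1 + 2 * \<i> * of_real s))) *
       (jacobi_fun b c (of_real s - \<i>) x - jacobi_fun b c (of_real s) x)
     = of_real (x * (1 + x)) * (p * q / of_real (b + c) * jacobi_fun (b + 1) c (of_real s) x)
       - of_real ((2 * b + 1) * x) * jacobi_fun b c (of_real s) x"
proof -
  have z: "- complex_of_real x \<in> slit_plane" using assms by simp
  have pos: "b + c > 0" using assms by simp
  have nz: "p \<noteq> 0" "q \<noteq> 0" "p - q \<noteq> 0" "1 - p + q \<noteq> 0" "1 - q + p \<noteq> 0"
    using assms by (auto simp: p_def q_def complex_eq_iff)
  have e: "p - q = 2 * \<i> * of_real s" "1 - p + q = 1 - 2 * \<i> * of_real s" "q - p = - 2 * \<i> * of_real s"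
    "1 - q + p = 1 + 2 * \<i> * of_real s" "of_real (b + c) - p = of_real c - \<i> * of_real s"
    "of_real (b + c) - q = of_real c + \<i> * of_real s" "p + q + 1 = of_real (2 * b + 1)"
    by (auto simp: p_def q_def)
  have j: "gauss_2F1 p q (of_real (b + c)) (- of_real x) = jacobi_fun b c (of_real s) x"
    "gauss_2F1 (p - 1) (q + 1) (of_real (b + c)) (- of_real x) = jacobi_fun b c (of_real s + \<i>) x"
    "gauss_2F1 (p + 1) (q - 1) (of_real (b + c)) (- of_real x) = jacobi_fun b c (of_real s - \<i>) x"
    "gauss_2F1 (p + 1) (q + 1) (of_real (b + c + 1)) (- of_real x) = jacobi_fun (b + 1) c (of_real s) x"
    by (simp_all add: p_def q_def jacobi_fun_def algebra_simps)
  have rearrange: "U + V = X * (1 + X) * Y - k * X * J"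
    if "- X * (1 - - X) * Y - k * - X * J + U + V = 0" for U V X Y k J :: complex
    using that by algebra
  show ?thesis
    using rearrange[OF gauss_2F1_contiguous[OF pos z nz, unfolded e j deriv_gauss_2F1[OF pos z]]]
    by (simp only: of_real_mult of_real_add of_real_1)
qed

subsection \<open>Improper integrals depending on a parameter\<close>

text \<open>A majorant of \<open>k\<close> alone suffices: Cauchy's inequality turns it into a
  majorant of the derivative on a smaller ball, hence of the difference quotients, and dominated
  convergence applies.\<close>

lemma holomorphic_on_integral_dominated:
  fixes k :: "complex \<Rightarrow> 'n::euclidean_space \<Rightarrow> complex"
  assumes hol: "\<And>x. x \<in> A \<Longrightarrow> (\<lambda>s. k s x) holomorphic_on S"
    and int: "\<And>s. s \<in> S \<Longrightarrow> k s integrable_on A"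
    and dom: "\<And>s. s \<in> S \<Longrightarrow> \<exists>r>0. \<exists>M. cball s r \<subseteq> S \<and> M integrable_on A \<and> (\<forall>w\<in>cball s r. \<forall>x\<in>A. norm (k w x) \<le> M x)"
  shows "(\<lambda>s. integral A (k s)) holomorphic_on S"
proof -
  have "((\<lambda>s. integral A (k s)) has_field_derivative integral A (\<lambda>x. deriv (\<lambda>s. k s x) s)) (at s)"
    if s: "s \<in> S" for s
  proof -
    obtain r M where r: "r > 0" "cball s r \<subseteq> S" and M: "M integrable_on A"
      and le: "\<And>w x. w \<in> cball s r \<Longrightarrow> x \<in> A \<Longrightarrow> norm (k w x) \<le> M x"
      using dom[OF s] by blast
    have deriv_at: "((\<lambda>s. k s x) has_field_derivative deriv (\<lambda>s. k s x) u) (at u)"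
      if "x \<in> A" "u \<in> ball s r" for x u
      using that r by (intro holomorphic_derivI[of _ "ball s r"] holomorphic_on_subset[OF hol]) auto
    have deriv_le: "norm (deriv (\<lambda>s. k s x) u) \<le> 2 * M x / r" if x: "x \<in> A" and u: "u \<in> ball s (r / 2)" for x u
    proof -
      have sub: "cball u (r / 2) \<subseteq> cball s r"
        using u by (intro subsetI) (auto intro: order_trans[OF dist_triangle[of s _ u]])
      then have sub2: "cball u (r / 2) \<subseteq> S" using r(2) by (rule order_trans)
      have "norm ((deriv ^^ 1) (\<lambda>s. k s x) u) \<le> fact 1 * M x / (r / 2) ^ 1"
      proof (rule Cauchy_inequality)
        show "(\<lambda>s. k s x) holomorphic_on ball u (r / 2)"
          by (rule holomorphic_on_subset[OF hol[OF x] order_trans[OF ball_subset_cball sub2]])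
        show "continuous_on (cball u (r / 2)) (\<lambda>s. k s x)"
          by (rule holomorphic_on_imp_continuous_on[OF holomorphic_on_subset[OF hol[OF x] sub2]])
        show "norm (k w x) \<le> M x" if "norm (u - w) = r / 2" for w
          using sub that by (intro le x) (auto simp: dist_norm)
      qed (use r in auto)
      then show ?thesis by (simp add: mult.commute)
    qed
    have quot_le: "norm ((k w x - k s x) / (w - s)) \<le> 2 * M x / r"
      if x: "x \<in> A" and w: "w \<in> ball s (r / 2)" "w \<noteq> s" for x w
    proof -
      have "norm (k w x - k s x) \<le> 2 * M x / r * norm (w - s)"
      proof (rule field_differentiable_bound[of "ball s (r / 2)" "\<lambda>s. k s x" "deriv (\<lambda>s. k s x)"])
        show "((\<lambda>s. k s x) has_field_derivative deriv (\<lambda>s. k s x) u) (at u within ball s (r / 2))"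
          if "u \<in> ball s (r / 2)" for u
          by (rule has_field_derivative_at_within[OF deriv_at[OF x]]) (use that r in auto)
        show "norm (deriv (\<lambda>s. k s x) u) \<le> 2 * M x / r" if "u \<in> ball s (r / 2)" for u
          using x that by (rule deriv_le)
        show "s \<in> ball s (r / 2)" using r by simp
      qed (use w in simp_all)
      then show ?thesis using w by (simp add: norm_divide divide_le_eq)
    qed
    show ?thesis
      unfolding has_field_derivative_iff tendsto_at_iff_sequentially
    proof (intro allI impI)
      fix X :: "nat \<Rightarrow> complex"
      assume X: "\<forall>i. X i \<in> UNIV - {s}" "X \<longlonglongrightarrow> s"
      have "\<forall>\<^sub>F i in sequentially. X i \<in> ball s (r / 2)"
        using X(2) r by (intro topological_tendstoD) auto
      then obtain N where N: "\<And>i. i \<ge> N \<Longrightarrow> X i \<in> ball s (r / 2)"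
        by (auto simp: eventually_sequentially)
      \<comment> \<open>Dominated convergence requires the majorant for every index, so the terms
        outside the ball are dropped.\<close>
      define Y where "Y i = X (i + N)" for i
      have Y: "Y i \<in> ball s (r / 2)" "Y i \<noteq> s" "Y i \<in> S" for i
        using N[of "i + N"] X r by (auto simp: Y_def subset_iff)
      have YL: "Y \<longlonglongrightarrow> s" unfolding Y_def using X(2) by (rule LIMSEQ_ignore_initial_segment)
      have "(\<lambda>i. integral A (\<lambda>x. (k (Y i) x - k s x) / (Y i - s))) \<longlonglongrightarrow> integral A (\<lambda>x. deriv (\<lambda>s. k s x) s)"
      proof (rule dominated_convergence(2))
        show "(\<lambda>x. (k (Y i) x - k s x) / (Y i - s)) integrable_on A" for i
          by (intro integrable_on_divide integrable_diff int Y s)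
        show "(\<lambda>x. 2 * M x / r) integrable_on A"
          by (intro integrable_on_divide integrable_on_mult_right M)
        show "norm ((k (Y i) x - k s x) / (Y i - s)) \<le> 2 * M x / r" if "x \<in> A" for i x
          using that Y by (intro quot_le)
        show "(\<lambda>i. (k (Y i) x - k s x) / (Y i - s)) \<longlonglongrightarrow> deriv (\<lambda>s. k s x) s" if "x \<in> A" for x
          using deriv_at[OF that, of s] r Y YL
          unfolding has_field_derivative_iff tendsto_at_iff_sequentially by (auto simp: o_def)
      qed
      moreover have eq: "integral A (\<lambda>x. (k (Y i) x - k s x) / (Y i - s)) = (integral A (k (Y i)) - integral A (k s)) / (Y i - s)" for i
        by (simp add: integral_diff int Y s)
      ultimately have "(\<lambda>i. (integral A (k (X (i + N))) - integral A (k s)) / (X (i + N) - s)) \<longlonglongrightarrow> integral A (\<lambda>x. deriv (\<lambda>s. k s x) s)"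
        unfolding eq unfolding Y_def by simp
      then show "((\<lambda>w. (integral A (k w) - integral A (k s)) / (w - s)) \<circ> X) \<longlonglongrightarrow> integral A (\<lambda>x. deriv (\<lambda>s. k s x) s)"
        unfolding o_def by (rule LIMSEQ_offset)
    qed
  qed
  then show ?thesis
    unfolding holomorphic_on_def field_differentiable_def using has_field_derivative_at_within by blast
qed

text \<open>By definition the integral over an unbounded set is a limit over boxes containing large
  balls; the box \<open>[-N, N]\<close> meets the half-line in \<open>{0..N}\<close>.\<close>

lemma integral_truncated_tendsto:
  fixes f :: "real \<Rightarrow> complex"
  assumes "f integrable_on {0..}"
  shows "((\<lambda>N. integral {0..N} f) \<longlongrightarrow> integral {0..} f) at_top"
proof (rule tendstoI)
  fix e :: real assume "e > 0"
  have "\<not> (\<exists>a b. {0::real..} = cbox a b)"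
  proof clarify
    fix a b :: real assume "{0..} = cbox a b"
    moreover have "max 0 b + 1 \<in> {0..}" by simp
    ultimately have "max 0 b + 1 \<in> cbox a b" by blast
    then show False by auto
  qed
  from has_integral_altD[OF integrable_integral[OF assms] this \<open>e > 0\<close>]
  obtain B where B: "B > 0" "\<forall>a b. ball 0 B \<subseteq> cbox a b \<longrightarrow>
      (\<exists>z. ((\<lambda>x. if x \<in> {0..} then f x else 0) has_integral z) (cbox a b) \<and> norm (z - integral {0..} f) < e)"
    by blast
  show "\<forall>\<^sub>F N in at_top. dist (integral {0..N} f) (integral {0..} f) < e"
    using eventually_ge_at_top[of B]
  proof eventually_elim
    case (elim N)
    have "ball 0 B \<subseteq> cbox (- N) N" using elim by (auto simp: abs_if split: if_splits)
    then obtain z where z: "((\<lambda>x. if x \<in> {0..} then f x else 0) has_integral z) (cbox (- N) N)" "norm (z - integral {0..} f) < e"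
      using B(2) by blast
    have int: "(f has_integral z) ({0..} \<inter> cbox (- N) N)"
      using z(1) by (subst (asm) has_integral_restrict_Int)
    have eq: "{0..} \<inter> cbox (- N) N = {0..N}" using elim B(1) by auto
    have "integral {0..N} f = z" using int unfolding eq by (rule integral_unique)
    then show ?case using z(2) by (simp add: dist_norm)
  qed
qed

subsection \<open>Convergence and integration by parts\<close>

definition index_weight :: "real \<Rightarrow> real \<Rightarrow> real \<Rightarrow> real" where
  "index_weight b c x = x powr (b + c - 1) * (1 + x) powr (b - c)"

lemma index_integrand_eq:
  "index_integrand b c f s x = f x * jacobi_fun b c s x * of_real (index_weight b c x)"
  by (simp add: index_integrand_def jacobi_fun_def index_weight_def)

text \<open>The weight behaves like \<open>x powr (b + c - 1)\<close> at 0 and like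
  \<open>x powr (2 * b - 1)\<close> at infinity. Decay of order \<open>- 2 * b - \<delta>\<close> is
  therefore the integrability criterion used throughout.\<close>

lemma integrable_index_weight:
  assumes "b > 0" "c > 0" "\<delta> > 0"
  shows "(\<lambda>x. index_weight b c x * (1 + x) powr (- 2 * b - \<delta>)) integrable_on {0..}"
proof -
  let ?M = "\<lambda>x. index_weight b c x * (1 + x) powr (- 2 * b - \<delta>)"
  have M: "?M x = x powr (b + c - 1) * (1 + x) powr (- (b + c) - \<delta>)" if "x \<ge> 0" for x
  proof -
    have "(1 + x) powr (b - c) * (1 + x) powr (- 2 * b - \<delta>) = (1 + x) powr (- (b + c) - \<delta>)"
      unfolding powr_add[symmetric] by (simp add: algebra_simps)
    then show ?thesis unfolding index_weight_def mult.assoc by simp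
  qed
  have meas: "?M \<in> borel_measurable (lebesgue_on A)" for A
    unfolding index_weight_def by (intro measurable_restrict_space1 measurable_completion) measurable
  have lower: "?M integrable_on {0..1}"
  proof (rule measurable_bounded_by_integrable_imp_integrable[OF meas])
    show "(\<lambda>x. x powr (b + c - 1)) integrable_on {0..1}" using assms by (intro integrable_on_powr_from_0) auto
    fix x :: real assume x: "x \<in> {0..1}"
    have "(1 + x) powr (- (b + c) - \<delta>) \<le> (1 + x) powr 0" using x assms by (intro powr_mono) auto
    then show "norm (?M x) \<le> x powr (b + c - 1)"
      using x M[of x] mult_left_mono[of "(1 + x) powr (- (b + c) - \<delta>)" 1 "x powr (b + c - 1)"] by (simp add: abs_mult)
  qed auto
  have upper: "?M integrable_on {1..}"
  proof (rule measurable_bounded_by_integrable_imp_integrable[OF meas])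
    show "(\<lambda>x. x powr (- 1 - \<delta>)) integrable_on {1..}"
      using has_integral_powr_to_inf[of "- 1 - \<delta>" 1] assms by (auto simp: integrable_on_def)
    fix x :: real assume x: "x \<in> {1..}"
    have "(1 + x) powr (- (b + c) - \<delta>) \<le> x powr (- (b + c) - \<delta>)" using x assms by (intro powr_mono2') auto
    then have "x powr (b + c - 1) * (1 + x) powr (- (b + c) - \<delta>) \<le> x powr (b + c - 1) * x powr (- (b + c) - \<delta>)"
      by (intro mult_left_mono) auto
    also have "\<dots> = x powr (- 1 - \<delta>)" unfolding powr_add[symmetric] by (simp add: algebra_simps)
    finally show "norm (?M x) \<le> x powr (- 1 - \<delta>)" using x M[of x] by (simp add: abs_mult)
  qed auto
  have "{0..1} \<inter> {1::real..} = {1}" by auto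
  then have "negligible ({0..1} \<inter> {1::real..})" by simp
  moreover have "{0::real..} = {0..1} \<union> {1..}" by auto
  ultimately show ?thesis by (rule integrable_Un'[OF lower upper])
qed

lemma weighted_dominated:
  fixes G :: "real \<Rightarrow> complex"
  assumes "norm (G x) \<le> K * (1 + x) powr (- 2 * b - \<delta>)"
  shows "norm (G x * of_real (index_weight b c x)) \<le> K * (index_weight b c x * (1 + x) powr (- 2 * b - \<delta>))"
proof -
  have "index_weight b c x \<ge> 0" by (simp add: index_weight_def)
  with mult_right_mono[OF assms this] show ?thesis by (simp add: norm_mult mult_ac)
qed

lemma integrable_weighted:
  fixes G :: "real \<Rightarrow> complex"
  assumes "b > 0" "c > 0" "\<delta> > 0" "continuous_on {0..} G"
    and G: "\<And>x. x \<ge> 0 \<Longrightarrow> norm (G x) \<le> K * (1 + x) powr (- 2 * b - \<delta>)"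
  shows "(\<lambda>x. G x * of_real (index_weight b c x)) integrable_on {0..}"
proof (rule measurable_bounded_by_integrable_imp_integrable)
  have *: "(\<lambda>x. complex_of_real (index_weight b c x)) \<in> borel_measurable (lebesgue_on {0..})"
    unfolding index_weight_def by (intro measurable_restrict_space1 measurable_completion) measurable
  show "(\<lambda>x. G x * of_real (index_weight b c x)) \<in> borel_measurable (lebesgue_on {0..})"
    by (intro borel_measurable_times continuous_imp_measurable_on_sets_lebesgue[OF assms(4)] *) auto
  show "(\<lambda>x. K * (index_weight b c x * (1 + x) powr (- 2 * b - \<delta>))) integrable_on {0..}"
    using assms by (intro integrable_on_mult_right integrable_index_weight)
qed (use G weighted_dominated in auto)

lemma
  fixes G :: "complex \<Rightarrow> real \<Rightarrow> complex"
  assumes bc: "b > 0" "c > 0"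
    and hol: "\<And>x. x \<ge> 0 \<Longrightarrow> (\<lambda>s. G s x) holomorphic_on S"
    and cont: "\<And>s. continuous_on {0..} (G s)"
    and bound: "\<And>s. s \<in> S \<Longrightarrow> \<exists>r K \<delta>. r > 0 \<and> \<delta> > 0 \<and> cball s r \<subseteq> S \<and>
      (\<forall>w\<in>cball s r. \<forall>x\<ge>0. norm (G w x) \<le> K * (1 + x) powr (- 2 * b - \<delta>))"
  shows integrable_weighted_family: "\<And>s. s \<in> S \<Longrightarrow> (\<lambda>x. G s x * of_real (index_weight b c x)) integrable_on {0..}"
    and holomorphic_weighted_integral: "(\<lambda>s. integral {0..} (\<lambda>x. G s x * of_real (index_weight b c x))) holomorphic_on S"
proof -
  show int: "(\<lambda>x. G s x * of_real (index_weight b c x)) integrable_on {0..}" if s: "s \<in> S" for s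
  proof -
    obtain r K \<delta> where "r > 0" "\<delta> > 0" "\<forall>w\<in>cball s r. \<forall>x\<ge>0. norm (G w x) \<le> K * (1 + x) powr (- 2 * b - \<delta>)"
      using bound[OF s] by blast
    then show ?thesis by (intro integrable_weighted[OF bc, of \<delta> _ K] cont) auto
  qed
  show "(\<lambda>s. integral {0..} (\<lambda>x. G s x * of_real (index_weight b c x))) holomorphic_on S"
  proof (rule holomorphic_on_integral_dominated)
    show "(\<lambda>s. G s x * of_real (index_weight b c x)) holomorphic_on S" if "x \<in> {0..}" for x
      using that by (intro holomorphic_intros hol) auto
    fix s assume s: "s \<in> S"
    obtain r K \<delta> where r: "r > 0" "\<delta> > 0" "cball s r \<subseteq> S"
      "\<forall>w\<in>cball s r. \<forall>x\<ge>0. norm (G w x) \<le> K * (1 + x) powr (- 2 * b - \<delta>)"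
      using bound[OF s] by blast
    show "\<exists>r>0. \<exists>M. cball s r \<subseteq> S \<and> M integrable_on {0..} \<and>
      (\<forall>w\<in>cball s r. \<forall>x\<in>{0..}. norm (G w x * of_real (index_weight b c x)) \<le> M x)"
    proof (intro exI[of _ r] exI[of _ "\<lambda>x. K * (index_weight b c x * (1 + x) powr (- 2 * b - \<delta>))"] conjI ballI)
      show "(\<lambda>x. K * (index_weight b c x * (1 + x) powr (- 2 * b - \<delta>))) integrable_on {0..}"
        using r bc by (intro integrable_on_mult_right integrable_index_weight)
      show "norm (G w x * of_real (index_weight b c x)) \<le> K * (index_weight b c x * (1 + x) powr (- 2 * b - \<delta>))"
        if "w \<in> cball s r" "x \<in> {0..}" for w x
        using that r by (intro weighted_dominated) auto
    qed (use r in auto)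
  qed (rule int)
qed

lemma smallo_powr_bound:
  fixes f :: "real \<Rightarrow> complex"
  assumes "continuous_on {0..} f" "e \<ge> 0" "f \<in> o[at_top](\<lambda>x. complex_of_real (x powr (- e)))"
  obtains K where "K > 0" "\<And>x. x \<ge> 0 \<Longrightarrow> norm (f x) \<le> K * (1 + x) powr (- e)"
proof -
  have "\<forall>\<^sub>F x in at_top. norm (f x) \<le> 1 * norm (complex_of_real (x powr (- e)))"
    using assms(3) by (rule landau_o.smallD) simp
  then obtain N0 where N0: "\<And>x. x \<ge> N0 \<Longrightarrow> norm (f x) \<le> x powr (- e)"
    by (auto simp: eventually_at_top_linorder)
  define N where "N = max 1 N0"
  have "bounded (f ` {0..N})"
    by (intro compact_imp_bounded compact_continuous_image continuous_on_subset[OF assms(1)]) auto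
  then obtain B where B: "B > 0" "\<And>x. x \<in> {0..N} \<Longrightarrow> norm (f x) \<le> B"
    unfolding bounded_pos by force
  \<comment> \<open>The first summand serves the compact interval up to \<open>N\<close>; the second
    serves the tail, where \<open>1 + x \<le> 2 * x\<close> because
    \<open>N \<ge> 1\<close>.\<close>
  define K where "K = B * (1 + N) powr e + 2 powr e"
  show ?thesis
  proof (rule that)
    have "B * (1 + N) powr e \<ge> 0" using B by simp
    then show "K > 0" unfolding K_def by (intro add_nonneg_pos) auto
    fix x :: real assume x: "x \<ge> 0"
    show "norm (f x) \<le> K * (1 + x) powr (- e)"
    proof (cases "x \<le> N")
      case True
      have "B = B * (1 + N) powr e * (1 + N) powr (- e)"
        using N_def by (simp add: powr_minus mult.assoc)
      also have "\<dots> \<le> B * (1 + N) powr e * (1 + x) powr (- e)"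
        using B True x assms(2) by (intro mult_left_mono powr_mono2') auto
      also have "\<dots> \<le> K * (1 + x) powr (- e)"
        unfolding K_def by (intro mult_right_mono) auto
      finally show ?thesis using B(2)[of x] True x by simp
    next
      case False
      then have x1: "x \<ge> 1" "x \<ge> N0" by (auto simp: N_def)
      have "norm (f x) \<le> x powr (- e)" using N0 x1 by simp
      also have "\<dots> = 2 powr e * (2 * x) powr (- e)"
        using x1 by (simp add: powr_mult powr_minus)
      also have "\<dots> \<le> 2 powr e * (1 + x) powr (- e)"
        using x1 assms(2) by (intro mult_left_mono powr_mono2') auto
      also have "\<dots> \<le> K * (1 + x) powr (- e)"
        unfolding K_def using B by (intro mult_right_mono) auto
      finally show ?thesis .
    qed
  qed
qed

lemma index_transform_eqI:
  assumes "\<And>N. N \<ge> 0 \<Longrightarrow> index_integrand b c f s integrable_on {0..N}"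
    and "(index_truncated b c f s \<longlongrightarrow> l) at_top"
  shows "index_converges b c f s" "index_transform b c f s = l"
  using assms tendsto_Lim[OF _ assms(2)] by (auto simp: index_converges_def index_transform_def)

lemma index_transform_eq_integral:
  assumes "index_integrand b c f s integrable_on {0..}"
  shows "index_converges b c f s"
    and "index_transform b c f s = of_real (1 / Gamma (b + c)) * integral {0..} (index_integrand b c f s)"
proof -
  have 1: "index_integrand b c f s integrable_on {0..N}" for N
    by (rule integrable_on_subinterval[OF assms]) auto
  have 2: "(index_truncated b c f s \<longlongrightarrow> of_real (1 / Gamma (b + c)) * integral {0..} (index_integrand b c f s)) at_top"
    unfolding index_truncated_def[abs_def] by (intro tendsto_intros integral_truncated_tendsto assms)
  show "index_converges b c f s"
    "index_transform b c f s = of_real (1 / Gamma (b + c)) * integral {0..} (index_integrand b c f s)"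
    using index_transform_eqI[OF 1 2] by auto
qed

text \<open>With \<open>\<sigma>\<close> midway between \<open>\<bar>Im s0\<bar>\<close> and
  \<open>1 + \<epsilon>\<close>, the exponents of \<open>f\<close> and of the kernel add up to
  \<open>- 2 * b - (1 + \<epsilon> - \<sigma>)\<close>. This is where the strip of holomorphy of
  \<open>g\<close> comes from.\<close>

lemma integrand_bound:
  fixes f :: "real \<Rightarrow> complex"
  assumes "b > 0" "c > 0" "\<bar>Im s0\<bar> < 1 + \<epsilon>" "Kf > 0"
    and f: "\<And>x. x \<ge> 0 \<Longrightarrow> norm (f x) \<le> Kf * (1 + x) powr (- b - 1 - \<epsilon>)"
  shows "\<exists>r K \<delta>. r > 0 \<and> \<delta> > 0 \<and> cball s0 r \<subseteq> {s. \<bar>Im s\<bar> < 1 + \<epsilon>} \<and>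
    (\<forall>s\<in>cball s0 r. \<forall>x\<ge>0. norm (f x * jacobi_fun b c s x) \<le> K * (1 + x) powr (- 2 * b - \<delta>))"
proof -
  define \<sigma> where "\<sigma> = (\<bar>Im s0\<bar> + (1 + \<epsilon>)) / 2"
  have \<sigma>: "\<bar>Im s0\<bar> < \<sigma>" "\<sigma> < 1 + \<epsilon>" using assms(3) by (auto simp: \<sigma>_def)
  obtain r K where rK: "r > 0" "K > 0"
    "\<And>s x. s \<in> cball s0 r \<Longrightarrow> x \<ge> 0 \<Longrightarrow> norm (jacobi_fun b c s x) \<le> K * (1 + x) powr (\<sigma> - b)"
    using jacobi_fun_bound[OF assms(1,2) \<sigma>(1)] by blast
  show ?thesis
  proof (rule exI[of _ "min r (\<sigma> - \<bar>Im s0\<bar>)"], rule exI[of _ "Kf * K"], rule exI[of _ "1 + \<epsilon> - \<sigma>"], intro conjI ballI allI impI)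
    show "cball s0 (min r (\<sigma> - \<bar>Im s0\<bar>)) \<subseteq> {s. \<bar>Im s\<bar> < 1 + \<epsilon>}"
    proof
      fix s assume "s \<in> cball s0 (min r (\<sigma> - \<bar>Im s0\<bar>))"
      then have "norm (s - s0) \<le> \<sigma> - \<bar>Im s0\<bar>" by (simp add: dist_norm norm_minus_commute)
      with abs_Im_le_cmod[of "s - s0"] \<sigma> show "s \<in> {s. \<bar>Im s\<bar> < 1 + \<epsilon>}" by auto
    qed
    fix s x assume s: "s \<in> cball s0 (min r (\<sigma> - \<bar>Im s0\<bar>))" and x: "(x::real) \<ge> 0"
    have "norm (f x * jacobi_fun b c s x) \<le> (Kf * (1 + x) powr (- b - 1 - \<epsilon>)) * (K * (1 + x) powr (\<sigma> - b))"
      unfolding norm_mult using s x by (intro mult_mono f rK) (use assms in auto)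
    also have "\<dots> = Kf * K * ((1 + x) powr (- b - 1 - \<epsilon>) * (1 + x) powr (\<sigma> - b))" by simp
    also have "(1 + x) powr (- b - 1 - \<epsilon>) * (1 + x) powr (\<sigma> - b) = (1 + x) powr (- 2 * b - (1 + \<epsilon> - \<sigma>))"
      unfolding powr_add[symmetric] by (simp add: algebra_simps)
    finally show "norm (f x * jacobi_fun b c s x) \<le> Kf * K * (1 + x) powr (- 2 * b - (1 + \<epsilon> - \<sigma>))" .
  qed (use rK \<sigma> in auto)
qed

text \<open>The function \<open>f\<close> times the derivative of \<open>x powr (b + c) * (1 + x) powr (b - c + 1) * jacobi_fun b c s x\<close>, divided by the
  weight.\<close>
definition adjoint_kernel :: "real \<Rightarrow> real \<Rightarrow> (real \<Rightarrow> complex) \<Rightarrow> complex \<Rightarrow> real \<Rightarrow> complex" where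
  "adjoint_kernel b c f s x = f x *
     (of_real (b + c + (2 * b + 1) * x) * jacobi_fun b c s x
      - of_real (x * (1 + x)) * ((of_real b + \<i> * s) * (of_real b - \<i> * s) / of_real (b + c) * jacobi_fun (b + 1) c s x))"

text \<open>Both terms exceed the kernel by one factor \<open>1 + x\<close>: the first through its
  linear coefficient, the second because \<open>x (1 + x)\<close> has degree two while the kernel
  for \<open>b + 1\<close> decays one order faster. This narrows the strip to
  \<open>\<bar>Im s\<bar> < \<epsilon>\<close>.\<close>

lemma adjoint_kernel_bound:
  fixes f :: "real \<Rightarrow> complex"
  assumes "b > 0" "c > 0" "\<bar>Im s0\<bar> < \<epsilon>" "Kf > 0"
    and f: "\<And>x. x \<ge> 0 \<Longrightarrow> norm (f x) \<le> Kf * (1 + x) powr (- b - 1 - \<epsilon>)"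
  shows "\<exists>r K \<delta>. r > 0 \<and> \<delta> > 0 \<and> cball s0 r \<subseteq> {s. \<bar>Im s\<bar> < \<epsilon>} \<and>
    (\<forall>s\<in>cball s0 r. \<forall>x\<ge>0. norm (adjoint_kernel b c f s x) \<le> K * (1 + x) powr (- 2 * b - \<delta>))"
proof -
  define \<sigma> where "\<sigma> = (\<bar>Im s0\<bar> + \<epsilon>) / 2"
  have \<sigma>: "\<bar>Im s0\<bar> < \<sigma>" "\<sigma> < \<epsilon>" using assms(3) by (auto simp: \<sigma>_def)
  obtain r1 K1 where 1: "r1 > 0" "K1 > 0"
    "\<And>s x. s \<in> cball s0 r1 \<Longrightarrow> x \<ge> 0 \<Longrightarrow> norm (jacobi_fun b c s x) \<le> K1 * (1 + x) powr (\<sigma> - b)"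
    using jacobi_fun_bound[OF assms(1,2) \<sigma>(1)] by blast
  have b1: "b + 1 > 0" using assms(1) by simp
  obtain r2 K2 where 2: "r2 > 0" "K2 > 0"
    "\<And>s x. s \<in> cball s0 r2 \<Longrightarrow> x \<ge> 0 \<Longrightarrow> norm (jacobi_fun (b + 1) c s x) \<le> K2 * (1 + x) powr (\<sigma> - (b + 1))"
    using jacobi_fun_bound[OF b1 assms(2) \<sigma>(1)] by blast
  define r where "r = min (min r1 r2) (\<sigma> - \<bar>Im s0\<bar>)"
  have r: "r > 0" using 1 2 \<sigma> by (simp add: r_def)
  define P where "P = b + norm s0 + r"
  have P: "P > 0" unfolding P_def using assms(1) r by (intro add_pos_pos add_pos_nonneg) auto
  define K where "K = (3 * b + c + 1) * K1 + P * P / (b + c) * K2"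
  show ?thesis
  proof (rule exI[of _ r], rule exI[of _ "Kf * K"], rule exI[of _ "\<epsilon> - \<sigma>"], intro conjI ballI allI impI)
    show "cball s0 r \<subseteq> {s. \<bar>Im s\<bar> < \<epsilon>}"
    proof
      fix s assume "s \<in> cball s0 r"
      then have "norm (s - s0) \<le> \<sigma> - \<bar>Im s0\<bar>" by (simp add: dist_norm norm_minus_commute r_def)
      with abs_Im_le_cmod[of "s - s0"] \<sigma> show "s \<in> {s. \<bar>Im s\<bar> < \<epsilon>}" by auto
    qed
    fix s x assume s: "s \<in> cball s0 r" and x: "(x::real) \<ge> 0"
    define Q where "Q = (1 + x) powr (\<sigma> - b + 1)"
    have Q1: "(1 + x) * (1 + x) powr (\<sigma> - b) = Q"
      using x powr_mult_base[of "1 + x" "\<sigma> - b"] by (simp add: Q_def add.commute)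
    have "(1 + x) * (1 + x) powr (\<sigma> - (b + 1)) = (1 + x) powr (\<sigma> - b)"
      using x powr_mult_base[of "1 + x" "\<sigma> - (b + 1)"] by simp
    then have Q2: "(1 + x) * (1 + x) * (1 + x) powr (\<sigma> - (b + 1)) = Q"
      by (simp only: mult.assoc Q1)
    have ns: "norm s \<le> norm s0 + r"
      using s norm_triangle_ineq2[of s s0] by (simp add: dist_norm norm_minus_commute)
    have np: "norm (of_real b + \<i> * s) \<le> P" "norm (of_real b - \<i> * s) \<le> P"
      using norm_triangle_ineq[of "of_real b" "\<i> * s"] norm_triangle_ineq4[of "of_real b" "\<i> * s"] ns assms(1)
      by (auto simp: norm_mult P_def)
    have a: "norm (of_real (b + c + (2 * b + 1) * x) * jacobi_fun b c s x) \<le> (3 * b + c + 1) * K1 * Q"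
    proof -
      have "norm (of_real (b + c + (2 * b + 1) * x) * jacobi_fun b c s x)
        \<le> ((3 * b + c + 1) * (1 + x)) * (K1 * (1 + x) powr (\<sigma> - b))"
        unfolding norm_mult
      proof (intro mult_mono 1(3))
        have "0 \<le> (2 * b + 1) + (b + c) * x" using assms x by (intro add_nonneg_nonneg mult_nonneg_nonneg) auto
        moreover have "0 \<le> (2 * b + 1) * x" using assms x by (intro mult_nonneg_nonneg) auto
        ultimately show "norm (complex_of_real (b + c + (2 * b + 1) * x)) \<le> (3 * b + c + 1) * (1 + x)"
          using assms unfolding norm_of_real by (simp add: algebra_simps)
      qed (use s x 1 2 assms in \<open>auto simp: r_def\<close>)
      also have "\<dots> = (3 * b + c + 1) * K1 * ((1 + x) * (1 + x) powr (\<sigma> - b))" by (simp only: mult_ac)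
      finally show ?thesis unfolding Q1 .
    qed
    have b: "norm (of_real (x * (1 + x)) * ((of_real b + \<i> * s) * (of_real b - \<i> * s) / of_real (b + c) * jacobi_fun (b + 1) c s x))
      \<le> P * P / (b + c) * K2 * Q"
    proof -
      have "norm (of_real (x * (1 + x)) * ((of_real b + \<i> * s) * (of_real b - \<i> * s) / of_real (b + c) * jacobi_fun (b + 1) c s x))
       = (x * (1 + x)) * (norm (of_real b + \<i> * s) * norm (of_real b - \<i> * s) / (b + c) * norm (jacobi_fun (b + 1) c s x))"
        using x assms by (simp only: norm_mult norm_divide norm_of_real) simp
      also have "\<dots> \<le> ((1 + x) * (1 + x)) * (P * P / (b + c) * (K2 * (1 + x) powr (\<sigma> - (b + 1))))"
        using s x assms np P 2(2)
        by (intro mult_mono divide_right_mono 2(3)) (auto simp: r_def intro!: mult_nonneg_nonneg divide_nonneg_nonneg)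
      also have "\<dots> = P * P / (b + c) * K2 * ((1 + x) * (1 + x) * (1 + x) powr (\<sigma> - (b + 1)))" by (simp only: mult_ac)
      finally show ?thesis unfolding Q2 .
    qed
    have "norm (adjoint_kernel b c f s x) \<le> (Kf * (1 + x) powr (- b - 1 - \<epsilon>)) * ((3 * b + c + 1) * K1 * Q + P * P / (b + c) * K2 * Q)"
      unfolding adjoint_kernel_def norm_mult[of "f x"]
      using x assms by (intro mult_mono f order_trans[OF norm_triangle_ineq4] add_mono a b) auto
    also have "\<dots> = Kf * K * ((1 + x) powr (- b - 1 - \<epsilon>) * Q)" by (simp add: K_def algebra_simps)
    also have "(1 + x) powr (- b - 1 - \<epsilon>) * Q = (1 + x) powr (- 2 * b - (\<epsilon> - \<sigma>))"
      unfolding Q_def powr_add[symmetric] by (simp add: algebra_simps)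
    finally show "norm (adjoint_kernel b c f s x) \<le> Kf * K * (1 + x) powr (- 2 * b - (\<epsilon> - \<sigma>))" .
  qed (use r \<sigma> in auto)
qed

lemma continuous_adjoint_kernel:
  assumes "b > 0" "c > 0" "continuous_on {0..} f"
  shows "continuous_on {0..} (adjoint_kernel b c f s)"
  unfolding adjoint_kernel_def using assms by (intro continuous_intros continuous_on_jacobi_fun) auto

lemma holomorphic_adjoint_kernel:
  assumes "b > 0" "c > 0" "x \<ge> 0"
  shows "(\<lambda>s. adjoint_kernel b c f s x) holomorphic_on S"
proof -
  have 1: "(\<lambda>s. jacobi_fun b c s x) holomorphic_on S" "(\<lambda>s. jacobi_fun (b + 1) c s x) holomorphic_on S"
    using assms by (auto intro: holomorphic_on_subset[OF holomorphic_jacobi_fun])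
  have "complex_of_real (b + c) \<noteq> 0" using assms by (metis add_pos_pos less_irrefl of_real_eq_0_iff)
  then show ?thesis unfolding adjoint_kernel_def by (intro holomorphic_intros 1)
qed

text \<open>The truncated integral for \<open>h\<close> equals the boundary term \<open>U N\<close>
  minus a truncation of an absolutely convergent integral. Since \<open>U N\<close> tends to 0, this
  gives convergence and value together.\<close>

lemma index_transform_derivative:
  fixes f f' :: "real \<Rightarrow> complex"
  assumes bc: "b > 0" "c > 0" and s: "\<bar>Im s\<bar> < \<epsilon>"
    and deriv: "\<And>x. x \<ge> 0 \<Longrightarrow> (f has_vector_derivative f' x) (at x within {0..})"
    and Kf: "Kf > 0" "\<And>x. x \<ge> 0 \<Longrightarrow> norm (f x) \<le> Kf * (1 + x) powr (- b - 1 - \<epsilon>)"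
  defines "h \<equiv> (\<lambda>x. complex_of_real (x * (x + 1)) * f' x)"
  shows "index_converges b c h s"
    and "index_transform b c h s =
      - of_real (1 / Gamma (b + c)) * integral {0..} (\<lambda>x. adjoint_kernel b c f s x * of_real (index_weight b c x))"
proof -
  define L where "L x = adjoint_kernel b c f s x * of_real (index_weight b c x)" for x
  \<comment> \<open>This is \<open>x (1 + x)\<close> times the weight. Since
    \<open>b + c > 0\<close>, it is continuous at 0 with value 0 even when the weight blows up
    there, so no boundary term arises at 0.\<close>
  define V where "V x = x powr (b + c) * (1 + x) powr (b - c + 1)" for x
  define U where "U x = f x * jacobi_fun b c s x * of_real (V x)" for x
  have contf: "continuous_on {0..} f"
    using deriv by (auto simp: continuous_on_eq_continuous_within intro: has_vector_derivative_continuous)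
  have base: "x powr (b + c) = x * x powr (b + c - 1)" "(1 + x) powr (b - c + 1) = (1 + x) * (1 + x) powr (b - c)"
    if "x > 0" for x
    using that powr_mult_base[of x "b + c - 1"] powr_mult_base[of "1 + x" "b - c"] by (simp_all add: add.commute)
  have V: "V x = x * (1 + x) * index_weight b c x" if "x > 0" for x
    unfolding V_def index_weight_def base[OF that] by (simp only: mult_ac)
  have dV: "(V has_real_derivative (b + c + (2 * b + 1) * x) * index_weight b c x) (at x)" if "x > 0" for x
  proof -
    have "(V has_real_derivative ((b + c) * x powr (b + c - 1)) * (1 + x) powr (b - c + 1)
       + x powr (b + c) * ((b - c + 1) * (1 + x) powr (b - c))) (at x)"
      unfolding V_def using that by (auto intro!: derivative_eq_intros)
    also have "((b + c) * x powr (b + c - 1)) * (1 + x) powr (b - c + 1) + x powr (b + c) * ((b - c + 1) * (1 + x) powr (b - c))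
       = ((b + c) * (1 + x) + (b - c + 1) * x) * index_weight b c x"
      unfolding index_weight_def base[OF that] by algebra
    also have "(b + c) * (1 + x) + (b - c + 1) * x = b + c + (2 * b + 1) * x" by algebra
    finally show ?thesis .
  qed
  have contU: "continuous_on {0..} U"
  proof -
    have "continuous_on {0..} V"
      unfolding V_def using bc by (intro continuous_on_mult continuous_on_powr') (auto intro!: continuous_intros)
    then show ?thesis unfolding U_def by (intro continuous_intros contf continuous_on_jacobi_fun bc)
  qed
  have dU: "(U has_vector_derivative index_integrand b c h s x + L x) (at x)" if x: "x > 0" for x
  proof -
    have "(f has_vector_derivative f' x) (at x within {0<..})"
      by (rule has_vector_derivative_within_subset[OF deriv]) (use x in auto)
    then have 1: "(f has_vector_derivative f' x) (at x)"
      using x by (simp add: at_within_open[of x "{0<..}"])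
    have 2: "(jacobi_fun b c s has_vector_derivative
       - ((of_real b + \<i> * s) * (of_real b - \<i> * s) / of_real (b + c) * jacobi_fun (b + 1) c s x)) (at x)"
      using x by (intro has_vector_derivative_jacobi_fun bc) auto
    have 3: "((\<lambda>x. complex_of_real (V x)) has_vector_derivative of_real ((b + c + (2 * b + 1) * x) * index_weight b c x)) (at x)"
      using dV[OF x] by (intro has_vector_derivative_of_real) (simp add: has_real_derivative_iff_has_vector_derivative)
    show ?thesis
      unfolding U_def
      by (rule has_vector_derivative_eq_rhs[OF has_vector_derivative_mult[OF has_vector_derivative_mult[OF 1 2] 3]])
         (simp add: V[OF x] L_def adjoint_kernel_def index_integrand_eq h_def algebra_simps)
  qed
  have U0: "U 0 = 0" using bc by (simp add: U_def V_def)
  have intU: "((\<lambda>x. index_integrand b c h s x + L x) has_integral U N) {0..N}" if "N \<ge> 0" for N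
    using fundamental_theorem_of_calculus_interior[OF that continuous_on_subset[OF contU] dU] U0 by auto
  have intL: "L integrable_on {0..}"
  proof -
    obtain r K \<delta> where "r > 0" "\<delta> > 0"
      "\<forall>s'\<in>cball s r. \<forall>x\<ge>0. norm (adjoint_kernel b c f s' x) \<le> K * (1 + x) powr (- 2 * b - \<delta>)"
      using adjoint_kernel_bound[OF bc s Kf] by blast
    then show ?thesis
      unfolding L_def by (intro integrable_weighted[OF bc, of \<delta> _ K] continuous_adjoint_kernel bc contf) auto
  qed
  have intLN: "L integrable_on {0..N}" for N
    by (rule integrable_on_subinterval[OF intL]) auto
  have intH: "(index_integrand b c h s has_integral U N - integral {0..N} L) {0..N}" if "N \<ge> 0" for N
    using has_integral_diff[OF intU[OF that] integrable_integral[OF intLN[of N]]] by simp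
  have U_lim: "(U \<longlongrightarrow> 0) at_top"
  proof -
    define \<sigma> where "\<sigma> = (\<bar>Im s\<bar> + \<epsilon>) / 2"
    have \<sigma>: "\<bar>Im s\<bar> < \<sigma>" "\<sigma> < \<epsilon>" using s by (auto simp: \<sigma>_def)
    obtain r K where rK: "r > 0" "K > 0"
      "\<And>s' x. s' \<in> cball s r \<Longrightarrow> x \<ge> 0 \<Longrightarrow> norm (jacobi_fun b c s' x) \<le> K * (1 + x) powr (\<sigma> - b)"
      using jacobi_fun_bound[OF bc \<sigma>(1)] by blast
    have bound: "norm (U x) \<le> Kf * K * (1 + x) powr (\<sigma> - \<epsilon>)" if "x > 0" for x
    proof -
      have "V x \<le> (1 + x) powr (b + c) * (1 + x) powr (b - c + 1)"
        unfolding V_def using bc that by (intro mult_right_mono powr_mono2) auto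
      moreover have "V x \<ge> 0" by (simp add: V_def)
      ultimately have "norm (U x) \<le> (Kf * (1 + x) powr (- b - 1 - \<epsilon>)) * (K * (1 + x) powr (\<sigma> - b)) *
          ((1 + x) powr (b + c) * (1 + x) powr (b - c + 1))"
        unfolding U_def norm_mult using that rK Kf by (intro mult_mono Kf(2) rK(3)) auto
      also have "\<dots> = Kf * K * ((1 + x) powr (- b - 1 - \<epsilon>) * (1 + x) powr (\<sigma> - b) *
          ((1 + x) powr (b + c) * (1 + x) powr (b - c + 1)))" by (simp only: mult_ac)
      also have "(1 + x) powr (- b - 1 - \<epsilon>) * (1 + x) powr (\<sigma> - b) *
          ((1 + x) powr (b + c) * (1 + x) powr (b - c + 1)) = (1 + x) powr (\<sigma> - \<epsilon>)"
        unfolding powr_add[symmetric] by (simp add: algebra_simps)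
      finally show ?thesis .
    qed
    \<comment> \<open>The exponent is negative by the choice of \<open>\<sigma>\<close> strictly
      below \<open>\<epsilon>\<close>.\<close>
    have "((\<lambda>x. Kf * K * (1 + x) powr (\<sigma> - \<epsilon>)) \<longlongrightarrow> Kf * K * 0) at_top"
      using \<sigma> by (intro tendsto_mult tendsto_const tendsto_neg_powr filterlim_tendsto_add_at_top[OF tendsto_const filterlim_ident]) auto
    moreover have "\<forall>\<^sub>F x in at_top. norm (U x) \<le> Kf * K * (1 + x) powr (\<sigma> - \<epsilon>)"
      using eventually_gt_at_top[of 0] by eventually_elim (rule bound)
    ultimately show ?thesis by (intro Lim_null_comparison[of U]) simp_all
  qed
  have "((\<lambda>N. of_real (1 / Gamma (b + c)) * (U N - integral {0..N} L)) \<longlongrightarrow> of_real (1 / Gamma (b + c)) * (0 - integral {0..} L)) at_top"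
    by (intro tendsto_intros U_lim integral_truncated_tendsto intL)
  moreover have "\<forall>\<^sub>F N in at_top. of_real (1 / Gamma (b + c)) * (U N - integral {0..N} L) = index_truncated b c h s N"
    using eventually_ge_at_top[of 0]
    by eventually_elim (simp add: index_truncated_def integral_unique[OF intH])
  ultimately have lim: "(index_truncated b c h s \<longlongrightarrow> - of_real (1 / Gamma (b + c)) * integral {0..} L) at_top"
    by (simp add: Lim_transform_eventually)
  show "index_converges b c h s"
    "index_transform b c h s = - of_real (1 / Gamma (b + c)) * integral {0..} (\<lambda>x. adjoint_kernel b c f s x * of_real (index_weight b c x))"
    using index_transform_eqI[OF _ lim] intH by (auto simp: L_def[abs_def] integrable_on_def)
qed

section \<open>The difference operator under the integral sign\<close>

lemma diff_H_eq:
  "diff_H b c u s =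
     (of_real b - \<i> * s) * (of_real b - \<i> * s + 1) * (of_real c - \<i> * s)
       / ((2 * \<i> * s) * (1 - 2 * \<i> * s)) * (u (s + \<i>) - u s)
   + (of_real b + \<i> * s) * (of_real b + \<i> * s + 1) * (of_real c + \<i> * s)
       / ((- 2 * \<i> * s) * (1 + 2 * \<i> * s)) * (u (s - \<i>) - u s)
   - of_real (b + c) * u s"
proof -
  have "of_real b + 1 - \<i> * s = of_real b - \<i> * s + 1" "of_real b + 1 + \<i> * s = of_real b + \<i> * s + 1"
    by simp_all
  then show ?thesis unfolding diff_H_def by (simp only:)
qed

text \<open>The contiguous relation in the form in which it is integrated: for fixed
  \<open>x\<close> the difference operator in \<open>s\<close>, applied to \<open>f x\<close> times
  the kernel, is the integrand left by the integration by parts. For real \<open>s\<close> the only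
  vanishing denominator is at \<open>s = 0\<close>.\<close>

lemma adjoint_kernel_eq:
  fixes s :: real
  assumes "b > 0" "c > 0" "x \<ge> 0" "s \<noteq> 0"
  shows "- adjoint_kernel b c f (of_real s) x = diff_H b c (\<lambda>s. f x * jacobi_fun b c s x) (of_real s)"
proof -
  define J where "J = jacobi_fun b c (of_real s) x"
  define A where "A = (of_real b - \<i> * of_real s) * (of_real b - \<i> * of_real s + 1) * (of_real c - \<i> * of_real s)
      / ((2 * \<i> * of_real s) * (1 - 2 * \<i> * of_real s))"
  define B where "B = (of_real b + \<i> * of_real s) * (of_real b + \<i> * of_real s + 1) * (of_real c + \<i> * of_real s)
      / ((- 2 * \<i> * of_real s) * (1 + 2 * \<i> * of_real s))"
  define Y where "Y = (of_real b + \<i> * of_real s) * (of_real b - \<i> * of_real s) / of_real (b + c) * jacobi_fun (b + 1) c (of_real s) x"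
  have "diff_H b c (\<lambda>s. f x * jacobi_fun b c s x) (of_real s) =
      f x * (A * (jacobi_fun b c (of_real s + \<i>) x - J) + B * (jacobi_fun b c (of_real s - \<i>) x - J)) - of_real (b + c) * (f x * J)"
    unfolding diff_H_eq A_def[symmetric] B_def[symmetric] J_def by algebra
  also have "A * (jacobi_fun b c (of_real s + \<i>) x - J) + B * (jacobi_fun b c (of_real s - \<i>) x - J)
      = of_real (x * (1 + x)) * Y - of_real ((2 * b + 1) * x) * J"
    unfolding A_def B_def J_def Y_def by (rule jacobi_fun_contiguous[OF assms])
  also have "f x * (of_real (x * (1 + x)) * Y - of_real ((2 * b + 1) * x) * J) - of_real (b + c) * (f x * J)
      = - (f x * (of_real (b + c + (2 * b + 1) * x) * J - of_real (x * (1 + x)) * Y))"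
    by (simp only: of_real_add) (simp add: algebra_simps)
  finally show ?thesis unfolding adjoint_kernel_def J_def Y_def by simp
qed

text \<open>\<open>index_transform\<close> is a \<open>Lim\<close> and has some value even without
  convergence, so the two convergence claims give the identity its meaning. The last conjunct
  expresses the value at \<open>s = 0\<close> by continuity.\<close>

theorem theorem2p2:
  fixes b c \<epsilon> :: real and f f' :: "real \<Rightarrow> complex"
  assumes "b > 0" and "c > 0" and "\<epsilon> > 0"
    and "\<And>x. x \<ge> 0 \<Longrightarrow> (f has_vector_derivative f' x) (at x within {0..})"
    and "continuous_on {0..} f" and "continuous_on {0..} f'"
    and "f \<in> o[at_top](\<lambda>x. complex_of_real (x powr (- b - 1 - \<epsilon>)))"
    and "f' \<in> o[at_top](\<lambda>x. complex_of_real (x powr (- b - 1 - \<epsilon>)))"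
  defines "g \<equiv> index_transform b c f"
    and "h \<equiv> (\<lambda>x. complex_of_real (x * (x + 1)) * f' x)"
  shows "(\<forall>s. \<bar>Im s\<bar> < 1 + \<epsilon> \<longrightarrow> index_converges b c f s)
    \<and> g holomorphic_on {s. \<bar>Im s\<bar> < 1 + \<epsilon>}
    \<and> (\<forall>s::real. index_converges b c h (of_real s))
    \<and> (\<forall>s::real. s \<noteq> 0 \<longrightarrow> index_transform b c h (of_real s) = diff_H b c g (of_real s))
    \<and> ((\<lambda>s::real. diff_H b c g (of_real s)) \<longlongrightarrow> index_transform b c h 0) (at 0)"
proof -
  note bc = assms(1,2) and deriv = assms(4) and contf = assms(5)
  let ?S = "{s. \<bar>Im s\<bar> < 1 + \<epsilon>}" and ?S' = "{s. \<bar>Im s\<bar> < \<epsilon>}"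
  let ?C = "complex_of_real (1 / Gamma (b + c))"
  define k where "k s x = f x * jacobi_fun b c s x * of_real (index_weight b c x)" for s x
  define L where "L s x = adjoint_kernel b c f s x * of_real (index_weight b c x)" for s x
  have e: "- b - 1 - \<epsilon> = - (b + 1 + \<epsilon>)" by simp
  have "b + 1 + \<epsilon> \<ge> 0" using assms(1,3) by simp
  from smallo_powr_bound[OF contf this assms(7)[unfolded e], folded e]
  obtain Kf where Kf: "Kf > 0" "\<And>x. x \<ge> 0 \<Longrightarrow> norm (f x) \<le> Kf * (1 + x) powr (- b - 1 - \<epsilon>)"
    by blast
  have hol_jacobi: "(\<lambda>s. f x * jacobi_fun b c s x) holomorphic_on ?S" if "x \<ge> 0" for x
    using that bc by (intro holomorphic_intros holomorphic_on_subset[OF holomorphic_jacobi_fun]) auto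
  have cont_jacobi: "continuous_on {0..} (\<lambda>x. f x * jacobi_fun b c s x)" for s
    by (intro continuous_intros continuous_on_jacobi_fun bc contf)
  note k_family = bc hol_jacobi cont_jacobi integrand_bound[OF bc _ Kf, unfolded mem_Collect_eq]
  have int_k: "k s integrable_on {0..}" if "s \<in> ?S" for s
    unfolding k_def using integrable_weighted_family[OF k_family] that by simp
  have hol_k: "(\<lambda>s. integral {0..} (k s)) holomorphic_on ?S"
    unfolding k_def using holomorphic_weighted_integral[OF k_family] by simp
  note L_family = bc holomorphic_adjoint_kernel[OF bc] continuous_adjoint_kernel[OF bc contf] adjoint_kernel_bound[OF bc _ Kf]
  have hol_L: "(\<lambda>s. integral {0..} (L s)) holomorphic_on ?S'"
    unfolding L_def using holomorphic_weighted_integral[OF L_family] by simp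
  have k_eq: "index_integrand b c f s = k s" for s
    by (rule ext) (simp add: index_integrand_eq k_def)
  have conv_f: "index_converges b c f s" and g_eq: "g s = ?C * integral {0..} (k s)" if "s \<in> ?S" for s
    using index_transform_eq_integral[of b c f s] int_k[OF that] unfolding k_eq g_def by auto
  have hol_g: "g holomorphic_on ?S"
    by (rule holomorphic_transform[of "\<lambda>s. ?C * integral {0..} (k s)"]) (auto intro!: holomorphic_intros hol_k simp: g_eq)
  have conv_h: "index_converges b c h s" and h_eq: "index_transform b c h s = - ?C * integral {0..} (L s)" if "s \<in> ?S'" for s
    using index_transform_derivative[OF bc _ deriv Kf, of s] that unfolding h_def L_def[abs_def] by auto
  have h_diff: "index_transform b c h (of_real s) = diff_H b c g (of_real s)" if "s \<noteq> 0" for s :: real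
  proof -
    define A where "A = (of_real b - \<i> * of_real s) * (of_real b + 1 - \<i> * of_real s) * (of_real c - \<i> * of_real s)
       / ((2 * \<i> * of_real s) * (1 - 2 * \<i> * of_real s))"
    define B where "B = (of_real b + \<i> * of_real s) * (of_real b + 1 + \<i> * of_real s) * (of_real c + \<i> * of_real s)
       / ((- 2 * \<i> * of_real s) * (1 + 2 * \<i> * of_real s))"
    have H: "diff_H b c u (of_real s) = A * (u (of_real s + \<i>) - u (of_real s)) + B * (u (of_real s - \<i>) - u (of_real s))
       - of_real (b + c) * u (of_real s)" for u
      by (simp add: diff_H_def A_def B_def)
    \<comment> \<open>The shifted points have imaginary part 1 or -1, inside the wide strip because
      \<open>\<epsilon> > 0\<close>. Thus all three integrals exist separately and linearity
      applies.\<close>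
    have in_S: "of_real s \<in> ?S" "of_real s + \<i> \<in> ?S" "of_real s - \<i> \<in> ?S" "complex_of_real s \<in> ?S'"
      using assms(3) by auto
    note int = int_k[OF in_S(1)] int_k[OF in_S(2)] int_k[OF in_S(3)]
    have L: "- L (of_real s) x = diff_H b c (\<lambda>s. k s x) (of_real s)" if "x \<in> {0..}" for x
    proof -
      have "- L (of_real s) x = (- adjoint_kernel b c f (of_real s) x) * of_real (index_weight b c x)"
        by (simp add: L_def)
      also have "\<dots> = diff_H b c (\<lambda>s. f x * jacobi_fun b c s x) (of_real s) * of_real (index_weight b c x)"
        using that \<open>s \<noteq> 0\<close> bc by (subst adjoint_kernel_eq) auto
      also have "\<dots> = diff_H b c (\<lambda>s. k s x) (of_real s)"
        unfolding H k_def by (simp add: algebra_simps)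
      finally show ?thesis .
    qed
    have "integral {0..} (\<lambda>x. - L (of_real s) x) = integral {0..} (\<lambda>x. A * (k (of_real s + \<i>) x - k (of_real s) x)
       + B * (k (of_real s - \<i>) x - k (of_real s) x) - of_real (b + c) * k (of_real s) x)"
      using L unfolding H by (rule integral_cong)
    also have "\<dots> = A * (integral {0..} (k (of_real s + \<i>)) - integral {0..} (k (of_real s)))
       + B * (integral {0..} (k (of_real s - \<i>)) - integral {0..} (k (of_real s))) - of_real (b + c) * integral {0..} (k (of_real s))"
      by (intro integral_unique has_integral_diff has_integral_add has_integral_mult_right integrable_integral int)
    finally have "- integral {0..} (L (of_real s)) = A * (integral {0..} (k (of_real s + \<i>)) - integral {0..} (k (of_real s)))
       + B * (integral {0..} (k (of_real s - \<i>)) - integral {0..} (k (of_real s))) - of_real (b + c) * integral {0..} (k (of_real s))"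
      by simp
    then have "?C * (- integral {0..} (L (of_real s))) = diff_H b c g (of_real s)"
      unfolding H g_eq[OF in_S(1)] g_eq[OF in_S(2)] g_eq[OF in_S(3)] by algebra
    then show ?thesis unfolding h_eq[OF in_S(4)] by simp
  qed
  have "((\<lambda>s::real. diff_H b c g (of_real s)) \<longlongrightarrow> index_transform b c h 0) (at 0)"
  proof -
    have "open ?S'"
      by (intro open_Collect_less continuous_intros)
    \<comment> \<open>The singular coefficients of the difference operator do not occur in
      \<open>L\<close>, so the integral is regular at 0; the identity for
      \<open>s \<noteq> 0\<close> carries its limit over to \<open>diff_H\<close>.\<close>
    then have "isCont (\<lambda>s. integral {0..} (L s)) 0"
      using holomorphic_on_imp_continuous_on[OF hol_L] assms(3) by (auto simp: continuous_on_eq_continuous_at)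
    moreover have "isCont complex_of_real 0" by (intro continuous_intros)
    ultimately have "isCont (\<lambda>s::real. integral {0..} (L (of_real s))) 0"
      using isCont_o2[of 0 complex_of_real "\<lambda>s. integral {0..} (L s)"] by simp
    then have "((\<lambda>s::real. integral {0..} (L (of_real s))) \<longlongrightarrow> integral {0..} (L 0)) (at 0)"
      by (simp add: isCont_def)
    then have "((\<lambda>s::real. - ?C * integral {0..} (L (of_real s))) \<longlongrightarrow> index_transform b c h 0) (at 0)"
      using tendsto_mult[OF tendsto_const[of "- ?C"]] h_eq[of 0] assms(3) by simp
    then show ?thesis
    proof (rule Lim_transform_eventually)
      show "\<forall>\<^sub>F s in at 0. - ?C * integral {0..} (L (complex_of_real s)) = diff_H b c g (of_real s)"
        unfolding eventually_at_filter using h_diff h_eq assms(3) by (intro always_eventually) auto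
    qed
  qed
  then show ?thesis using conv_f hol_g conv_h h_diff assms(3) by auto
qed

end
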